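(* Let $k\ge1$, $n$, and $1\le s_1<s_2<\dots<s_k<n$ be integers such that the circulant graph $C_{2n}(s_1,\dots,s_k,n)$ is connected (i.e. $\gcd(s_1,\dots,s_k,n)=1$). Let $\tau(n)$ be the number of spanning trees of $C_{2n}(s_1,\dots,s_k,n)$. Put $q=s_1^2+\dots+s_k^2$ and $$P(w)=2k+1-2\sum_{i=1}^kT_{s_i}(w).$$ Then $$\tau(n)=\frac{n\,4^{s_k-1}}{q}\prod_{p=1}^{s_k-1}\bigl(T_n(u_p)-1\bigr)\prod_{p=1}^{s_k}\bigl(T_n(v_p)+1\bigr),$$ where $u_1,\dots,u_{s_k-1}$ are the complex roots different from $1$ of the equation $P(u)-1=0$ and $v_1,\dots,v_{s_k}$ are the complex roots of the equation $P(v)+1=0$ (roots counted with multiplicity).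
   Context: $C_{2n}(s_1,\dots,s_k,n)$ is the graph with vertices $0,1,\dots,2n-1$ in which each vertex $i$ is adjacent to the vertices $i\pm s_1,\dots,i\pm s_k$ and $i+n \pmod{2n}$ (a single edge joins $i$ and $i+n$, so every vertex has degree $2k+1$). $T_m$ denotes the Chebyshev polynomial of the first kind, $T_m(\cos\varphi)=\cos(m\varphi)$. An empty product equals $1$. The polynomial $P(u)-1$ has degree $s_k$ and has $u=1$ as a simple root. *)

theory Defs
  imports
    "Graph_Theory.Graph_Theory"
    "HOL-Computational_Algebra.Computational_Algebra"
    "HOL-Number_Theory.Cong"
    Complex_Main
begin

text \<open>
  An undirected graph is a symmetric digraph, as in \<open>Graph_Theory\<close>; an edge is a pair of
  opposite arcs. Hence a jump \<open>a\<close> with \<open>2 * a = m\<close> contributes one edge at each vertex.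
\<close>

definition circulant_graph :: "nat \<Rightarrow> nat set \<Rightarrow> nat pair_pre_digraph" where
  "circulant_graph m A =
    \<lparr> pverts = {0..<m},
      parcs = {(i, j). i < m \<and> j < m \<and>
        (\<exists>a\<in>A. [int j = int i + int a] (mod int m) \<or> [int j = int i - int a] (mod int m))} \<rparr>"

lemma pair_graph_circulant_graph:
  assumes "\<And>a. a \<in> A \<Longrightarrow> 0 < a \<and> a < m"
  shows "pair_graph (circulant_graph m A)"
proof
  let ?G = "circulant_graph m A"
  have sub: "parcs ?G \<subseteq> {0..<m} \<times> {0..<m}"
    by (auto simp: circulant_graph_def)
  show "finite (parcs ?G)"
    by (rule finite_subset[OF sub]) simp
  show "fst e \<in> pverts ?G" "snd e \<in> pverts ?G" if "e \<in> parcs ?G" for e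
    using that by (auto simp: circulant_graph_def)
  show "finite (pverts ?G)"
    by (simp add: circulant_graph_def)
  show "fst e \<noteq> snd e" if e: "e \<in> parcs ?G" for e
  proof
    assume eq: "fst e = snd e"
    have "\<exists>i. \<exists>a\<in>A. [int i = int i + int a] (mod int m) \<or> [int i = int i - int a] (mod int m)"
      using e eq by (cases e) (auto simp: circulant_graph_def)
    then obtain i a where a: "a \<in> A"
      and "[int i = int i + int a] (mod int m) \<or> [int i = int i - int a] (mod int m)"
      by blast
    then have "int m dvd int a"
      by (auto simp: cong_iff_dvd_diff)
    then show False
      using assms[OF a] by (auto dest: dvd_imp_le)
  qed
  show "symmetric ?G"
  proof -
    have flip: "[y = x - a] (mod c)" if "[x = y + a] (mod c)" for x y a c :: int
    proof -
      have "x - a - y = x - (y + a)" by simp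
      then show ?thesis
        using that by (metis cong_iff_dvd_diff cong_sym)
    qed
    have flip': "[y = x + a] (mod c)" if "[x = y - a] (mod c)" for x y a c :: int
      using flip[of x y "- a" c] that by simp
    show ?thesis
      unfolding symmetric_def with_proj_simps
    proof (rule symI)
      fix i j assume "(i, j) \<in> parcs ?G"
      then obtain a where "i < m" "j < m" "a \<in> A"
        and "[int j = int i + int a] (mod int m) \<or> [int j = int i - int a] (mod int m)"
        unfolding circulant_graph_def by auto
      moreover from this
      have "[int i = int j + int a] (mod int m) \<or> [int i = int j - int a] (mod int m)"
        using flip[of "int j" "int i" "int a" "int m"] flip'[of "int j" "int i" "int a" "int m"]
        by argo
      ultimately show "(j, i) \<in> parcs ?G"
        unfolding circulant_graph_def by auto
    qed
  qed
qed

text \<open>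
  The library's \<^const>\<open>spanning_tree\<close> is for digraphs: it counts the closed walk \<open>a, b, a\<close> as
  a cycle, and it accepts an acyclically oriented triangle. So here the subgraph has to be
  symmetric, and its cycles are those with at least three arcs.
\<close>

definition undirected_spanning_trees :: "'a pair_pre_digraph \<Rightarrow> 'a pair_pre_digraph set" where
  "undirected_spanning_trees G =
    {H. spanning (with_proj H) (with_proj G) \<and> symmetric (with_proj H) \<and>
        Digraph_Component.connected (with_proj H) \<and>
        \<not> (\<exists>p. pre_digraph.cycle (with_proj H) p \<and> 3 \<le> length p)}"

fun chebyshev_T :: "nat \<Rightarrow> 'a::comm_ring_1 poly" where
  "chebyshev_T 0 = 1"
| "chebyshev_T (Suc 0) = [:0, 1:]"
| "chebyshev_T (Suc (Suc m)) = 2 * [:0, 1:] * chebyshev_T (Suc m) - chebyshev_T m"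

lemma poly_chebyshev_T_cos:
  fixes z :: "'a::{real_normed_field,banach}"
  shows "poly (chebyshev_T m) (cos z) = cos (of_nat m * z)"
proof (induction m rule: chebyshev_T.induct)
  case (3 m)
  have "cos (of_nat (Suc (Suc m)) * z) + cos (of_nat m * z) = 2 * cos z * cos (of_nat (Suc m) * z)"
    using cos_add[of "of_nat (Suc m) * z" z] cos_diff[of "of_nat (Suc m) * z" z]
    by (simp add: algebra_simps)
  then show ?case
    using 3 by (simp add: algebra_simps)
qed simp_all

definition circulant_poly :: "(nat \<Rightarrow> nat) \<Rightarrow> nat \<Rightarrow> complex poly" where
  "circulant_poly s k = of_nat (2 * k + 1) - 2 * (\<Sum>i = 1..k. chebyshev_T (s i))"

lemma chebyshev_T_coeff:
  "degree (chebyshev_T m :: complex poly) \<le> m \<and>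
   coeff (chebyshev_T m :: complex poly) m = 2 ^ (m - 1)"
proof (induction m rule: chebyshev_T.induct)
  case (3 m)
  let ?T = "chebyshev_T :: nat \<Rightarrow> complex poly"
  have eq: "?T (Suc (Suc m)) = smult 2 (pCons 0 (?T (Suc m))) - ?T m"
    by (simp add: numeral_poly)
  have "degree (smult 2 (pCons 0 (?T (Suc m)))) \<le> Suc (Suc m)"
    using 3 by (simp add: degree_pCons_eq_if)
  moreover have "coeff (?T m) (Suc (Suc m)) = 0"
    using 3 by (intro coeff_eq_0) auto
  ultimately show ?case
    unfolding eq using 3 by (auto intro: degree_diff_le)
qed simp_all

lemma poly_chebyshev_T_1: "poly (chebyshev_T m) 1 = 1"
  by (induction m rule: chebyshev_T.induct) simp_all

lemma poly_pderiv_chebyshev_T_1: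
  "poly (pderiv (chebyshev_T m :: complex poly)) 1 = of_nat (m\<^sup>2)"
proof (induction m rule: chebyshev_T.induct)
  case (3 m)
  let ?T = "chebyshev_T :: nat \<Rightarrow> complex poly"
  have eq: "?T (Suc (Suc m)) = smult 2 (pCons 0 (?T (Suc m))) - ?T m"
    by (simp add: numeral_poly)
  show ?case
    unfolding eq using 3
    by (simp add: pderiv_diff pderiv_smult pderiv_pCons poly_chebyshev_T_1 power2_eq_square
        algebra_simps del: chebyshev_T.simps)
qed (simp_all add: pderiv_pCons)

lemma circulant_poly_smult:
  "circulant_poly s k = [:of_nat (2 * k + 1):] - smult 2 (\<Sum>i = 1..k. chebyshev_T (s i))"
  by (simp add: circulant_poly_def of_nat_poly numeral_poly)

context
  fixes s :: "nat \<Rightarrow> nat" and k :: nat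
  assumes k: "1 \<le> k" and s1: "1 \<le> s 1" and s_mono: "strict_mono_on {1..k} s"
begin

lemma s_pos: "i \<in> {1..k} \<Longrightarrow> 1 \<le> s i"
  using s1 strict_mono_on_leD[OF s_mono, of 1 i] by auto

lemma degree_circulant_poly_diff: "degree (circulant_poly s k - [:c:]) = s k"
proof -
  let ?S = "\<Sum>i = 1..k. chebyshev_T (s i) :: complex poly"
  let ?Q = "[:of_nat (2 * k + 1) - c:] :: complex poly"
  have eq: "circulant_poly s k - [:c:] = ?Q - smult 2 ?S"
    by (simp add: circulant_poly_smult)
  have le: "s i \<le> s k" if "i \<in> {1..k}" for i
    using that k strict_mono_on_leD[OF s_mono, of i k] by auto
  have lt: "s i < s k" if "i \<in> {1..k} - {k}" for i
    using that k strict_mono_onD[OF s_mono, of i k] by auto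
  have degS: "degree ?S \<le> s k"
    using chebyshev_T_coeff le by (intro degree_sum_le) (auto intro: order_trans)
  have "coeff ?S (s k) = (\<Sum>i = 1..k. coeff (chebyshev_T (s i)) (s k))"
    by (simp add: coeff_sum)
  also have "\<dots> = coeff (chebyshev_T (s k)) (s k) +
      (\<Sum>i \<in> {1..k} - {k}. coeff (chebyshev_T (s i)) (s k))"
    using k by (subst sum.remove[of _ k]) auto
  also have "(\<Sum>i \<in> {1..k} - {k}. coeff (chebyshev_T (s i) :: complex poly) (s k)) = 0"
    using lt chebyshev_T_coeff by (intro sum.neutral ballI coeff_eq_0) (auto intro: le_less_trans)
  finally have cS: "coeff ?S (s k) = 2 ^ (s k - 1)"
    using chebyshev_T_coeff by simp
  have "coeff (?Q - smult 2 ?S) (s k) \<noteq> 0"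
    using cS s_pos[of k] k by (auto simp: coeff_pCons split: nat.split)
  moreover have "degree (?Q - smult 2 ?S) \<le> s k"
    using degS by (intro degree_diff_le) (auto intro: order_trans[OF degree_smult_le])
  ultimately show ?thesis
    unfolding eq by (intro antisym le_degree)
qed

lemma order_1_circulant_poly: "order 1 (circulant_poly s k - 1) = 1"
proof -
  let ?p = "circulant_poly s k - 1"
  have ne: "?p \<noteq> 0"
    using degree_circulant_poly_diff[of 1] s_pos[of k] k by (auto simp: one_pCons)
  have root: "poly ?p 1 = 0"
    by (simp add: circulant_poly_smult poly_sum poly_chebyshev_T_1)
  have "poly (pderiv ?p) 1 = - 2 * of_nat (\<Sum>i = 1..k. (s i)\<^sup>2)"
    by (simp add: circulant_poly_smult pderiv_diff pderiv_smult pderiv_pCons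
        higher_pderiv_sum[of 1, simplified] poly_sum poly_pderiv_chebyshev_T_1 del: of_nat_power)
  moreover have "0 < (\<Sum>i = 1..k. (s i)\<^sup>2)"
    using k s1 by (intro sum_pos2[of _ 1]) auto
  ultimately have "poly (pderiv ?p) 1 \<noteq> 0"
    by (metis mult_eq_0_iff neg_equal_0_iff_equal of_nat_eq_0_iff less_irrefl zero_neq_numeral)
  then have "order 1 (pderiv ?p) = 0" and "pderiv ?p \<noteq> 0"
    by (auto simp: order_root)
  then show ?thesis
    using order_pderiv[of ?p 1] ne root by (auto simp: order_root)
qed

text \<open>
  A product over these multisets of roots (with multiplicity) has \<open>s k - 1\<close> resp. \<open>s k\<close> factors,
  so it is \<open>\<Prod>p = 1..s k - 1\<close> resp. \<open>\<Prod>p = 1..s k\<close> for any enumeration of the roots.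
\<close>

lemma size_proots_circulant_poly:
  "size (filter_mset (\<lambda>u. u \<noteq> 1) (proots (circulant_poly s k - 1))) = s k - 1"
  "size (proots (circulant_poly s k + 1)) = s k"
proof -
  let ?p = "circulant_poly s k - 1"
  have deg: "degree ?p = s k"
    using degree_circulant_poly_diff[of 1] by (simp add: one_pCons)
  then have ne: "?p \<noteq> 0"
    using s_pos[of k] k by auto
  have "size (proots ?p) = size (filter_mset (\<lambda>u. u = 1) (proots ?p)) +
      size (filter_mset (\<lambda>u. u \<noteq> 1) (proots ?p))"
    by (metis multiset_partition size_union)
  moreover have "size (filter_mset (\<lambda>u. u = 1) (proots ?p)) = 1"
    using ne order_1_circulant_poly by (simp add: filter_eq_replicate_mset)
  ultimately show "size (filter_mset (\<lambda>u. u \<noteq> 1) (proots ?p)) = s k - 1"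
    by (simp add: size_proots_complex deg)
  have "circulant_poly s k + 1 = circulant_poly s k - [:-1:]"
    by (simp add: one_pCons)
  then show "size (proots (circulant_poly s k + 1)) = s k"
    using degree_circulant_poly_diff[of "-1"] by (simp only: size_proots_complex)
qed

end

end

theory Submission
  imports Defs "Jordan_Normal_Form.Determinant"
begin

text \<open>
  By the matrix-tree theorem, the number of spanning trees of a graph with \<open>N\<close> vertices is
  \<open>1 / N\<close> times the product of the eigenvalues of its Laplacian, without the eigenvalue \<open>0\<close> of
  the constant vector. For a circulant graph on \<open>N = 2 n\<close> vertices these eigenvalues are
  explicit. Let \<open>\<omega>\<close> be a primitive \<open>2 n\<close>-th root of unity and let \<open>x\<^sub>m = (\<omega>\<^sup>m + \<omega>\<^sup>-\<^sup>m) / 2\<close>.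
  Since \<open>T\<^sub>s ((z + 1 / z) / 2) = (z\<^sup>s + 1 / z\<^sup>s) / 2\<close> and \<open>\<omega>\<^sup>n = -1\<close>, the eigenvalue with
  index \<open>m\<close> is \<open>P x\<^sub>m - (-1)\<^sup>m\<close>. So the even indices contribute values of \<open>P - 1\<close> at the
  points \<open>cos (2 \<pi> k / n)\<close>, the odd ones values of \<open>P + 1\<close> at \<open>cos ((2 k + 1) \<pi> / n)\<close>.

  These two families of points are the roots of \<open>T\<^sub>n - 1\<close> and of \<open>T\<^sub>n + 1\<close>
  (\<open>chebyshev_T_diff_factorization\<close>). Hence a product of values of a polynomial over one of
  the families is a resultant, and exchanging the two polynomials in it gives a product of
  \<open>T\<^sub>n \<mp> 1\<close> over the roots of \<open>P \<mp> 1\<close> (\<open>prod_poly_chebyshev_nodes\<close>). In the even family the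
  index \<open>0\<close>, where \<open>P - 1\<close> vanishes at the node \<open>1\<close>, has to be left out; the factors
  \<open>n\<^sup>2 = T\<^sub>n' 1\<close> and \<open>-2 q = (P - 1)' 1\<close> record the removal of this common root. The signs and
  powers of two cancel between the two families.

  The matrix-tree theorem is proved with parent functions: once a root \<open>r\<close> is chosen, a
  spanning tree is the same as a map that sends each other vertex to a neighbour and along
  which some rank decreases (\<open>card_undirected_spanning_trees\<close>). Expanding the Laplacian
  determinant by multilinearity in its rows produces one term for each map from vertices to
  vertices, and that term is \<open>1\<close> or \<open>0\<close> according to whether a rank exists
  (\<open>det_parent_matrix\<close>). An extra vertex joined to every vertex with weight \<open>x\<close> keeps all rows
  alike, so that the matrix of a circulant graph remains circulant; the trees are then found
  in the coefficient of \<open>x\<close> (\<open>matrix_tree\<close>).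
\<close>

section \<open>Spanning trees as parent functions\<close>

text \<open>
  For a finite \<open>V\<close> that the map \<open>f\<close> leaves only through a root, the existence of a decreasing
  rank says that iterating \<open>f\<close> leads from each point of \<open>V\<close> to the root. The rank is the form
  that inductions and extremal arguments use.
\<close>

definition grounded :: "'a set \<Rightarrow> ('a \<Rightarrow> 'a) \<Rightarrow> bool" where
  "grounded V f \<longleftrightarrow> (\<exists>d :: 'a \<Rightarrow> nat. \<forall>v\<in>V. d (f v) < d v)"

text \<open>
  The functions are the identity off \<open>pverts G - {r}\<close>, so that distinct elements differ at a
  vertex where they carry information.
\<close>

definition parent_functions :: "'a pair_pre_digraph \<Rightarrow> 'a \<Rightarrow> ('a \<Rightarrow> 'a) set" where
  "parent_functions G r = {f. (\<forall>v\<in>pverts G - {r}. (v, f v) \<in> parcs G) \<and>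
     (\<forall>v. v \<notin> pverts G - {r} \<longrightarrow> f v = v) \<and> grounded (pverts G - {r}) f}"

definition parent_tree :: "'a set \<Rightarrow> 'a \<Rightarrow> ('a \<Rightarrow> 'a) \<Rightarrow> 'a pair_pre_digraph" where
  "parent_tree V r f = \<lparr> pverts = V,
     parcs = (\<lambda>v. (v, f v)) ` (V - {r}) \<union> (\<lambda>v. (f v, v)) ` (V - {r}) \<rparr>"

lemma mk_symmetric_symmetric:
  assumes "symmetric (with_proj H)"
  shows "mk_symmetric (with_proj H) = H"
  using assms by (auto simp: mk_symmetric_def symmetric_def sym_def intro!: pair_pre_digraph.equality)

text \<open>
  Connectedness is defined through the symmetric closure of the arc set, which changes nothing
  here.
\<close>

lemma connected_symmetric_iff:
  assumes "symmetric (with_proj H)"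
  shows "Digraph_Component.connected (with_proj H) \<longleftrightarrow> strongly_connected (with_proj H)"
  by (simp add: Digraph_Component.connected_def mk_symmetric_symmetric[OF assms])

text \<open>
  Indexed access to the vertices of a walk makes it possible to move around a closed walk
  cyclically without rotating the list.
\<close>

lemma pcas_nth:
  assumes "pcas u p v" "i < length p"
  shows "fst (p ! i) = (if i = 0 then u else snd (p ! (i - 1)))"
  using assms
proof (induction p arbitrary: u i)
  case (Cons e p)
  show ?case
  proof (cases i)
    case (Suc j)
    then show ?thesis using Cons.IH[of "snd e" j] Cons.prems by (cases j) auto
  qed (use Cons in auto)
qed simp

lemma pcas_last: "pcas u p v \<Longrightarrow> p \<noteq> [] \<Longrightarrow> snd (last p) = v"
  by (induction p arbitrary: u) auto

text \<open>
  At a vertex of maximal rank on a cycle, both neighbours on the cycle have at most that rank,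
  and the only such neighbour in the tree is the parent. On a cycle with at least three arcs
  these two neighbours are different.
\<close>

lemma parent_tree_acyclic:
  assumes "\<forall>v\<in>V - {r}. d (f v) < (d v :: nat)"
  shows "\<not> (\<exists>p. pre_digraph.cycle (with_proj (parent_tree V r f)) p \<and> 3 \<le> length p)"
proof
  let ?H = "parent_tree V r f"
  assume "\<exists>p. pre_digraph.cycle (with_proj ?H) p \<and> 3 \<le> length p"
  then obtain p u where p: "set p \<subseteq> parcs ?H" "pcas u p u" and "distinct (tl (pawalk_verts u p))"
    and len: "3 \<le> length p"
    by (auto simp: pre_digraph.cycle_def pre_digraph.awalk_def awalk_verts_with_proj_eq cas_with_proj_eq)
  moreover have "tl (pawalk_verts u p) = map snd p"
    using pre_digraph.awalk_verts_conv'[of "with_proj ?H" u p u] p(2) len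
    by (auto simp: awalk_verts_with_proj_eq cas_with_proj_eq)
  ultimately have dist: "distinct (map snd p)" by simp
  \<comment> \<open>The vertex \<open>h i\<close> ends the \<open>i\<close>-th arc; \<open>pre\<close> and \<open>suc\<close> are the cyclic neighbours of an index.\<close>
  define m where "m = length p"
  define h where "h i = snd (p ! i)" for i
  define pre where "pre i = (if i = 0 then m - 1 else i - 1)" for i
  define suc where "suc i = (if i = m - 1 then 0 else Suc i)" for i
  have m: "3 \<le> m" using len by (simp add: m_def)
  have pre_lt: "pre i < m" and suc_lt: "suc i < m" and pre_suc: "pre (suc i) = i"
    and pre_neq_suc: "pre i \<noteq> suc i" if "i < m" for i
    using that m by (auto simp: pre_def suc_def split: if_splits)
  have inj: "h i = h j \<longleftrightarrow> i = j" if "i < m" "j < m" for i j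
    using that dist unfolding h_def m_def distinct_conv_nth by (metis length_map nth_map)
  have arc: "(h (pre i), h i) \<in> parcs ?H" if "i < m" for i
  proof -
    have "snd (last p) = u" using pcas_last[OF p(2)] len by fastforce
    then have "fst (p ! i) = h (pre i)"
      using pcas_nth[OF p(2), of i] that len last_conv_nth[of p]
      by (auto simp: pre_def h_def m_def)
    then have "p ! i = (h (pre i), h i)" by (simp add: h_def prod_eq_iff)
    then show ?thesis using p(1) that nth_mem[of i p] by (auto simp: m_def)
  qed
  have "(d \<circ> h) ` {..<m} \<noteq> {}"
    using m by (simp add: lessThan_empty_iff)
  from Max_in[OF _ this] obtain i where i: "i < m" and "Max ((d \<circ> h) ` {..<m}) = d (h i)"
    by auto
  then have max: "d (h j) \<le> d (h i)" if "j < m" for j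
    using Max_ge[of "(d \<circ> h) ` {..<m}" "d (h j)"] that by auto
  have only: "w = f (h i)" if "(w, h i) \<in> parcs ?H \<or> (h i, w) \<in> parcs ?H" "d w \<le> d (h i)" for w
    using that assms by (auto simp: parent_tree_def) (metis DiffI leD singletonD)+
  have "h (pre i) = f (h i)"
    using only[of "h (pre i)"] arc[OF i] max[OF pre_lt[OF i]] by blast
  moreover have "h (suc i) = f (h i)"
    using only[of "h (suc i)"] arc[OF suc_lt[OF i]] max[OF suc_lt[OF i]] pre_suc[OF i] by auto
  ultimately show False
    using inj[OF pre_lt[OF i] suc_lt[OF i]] pre_neq_suc[OF i] by simp
qed

lemma parent_tree_strongly_connected:
  assumes r: "r \<in> V" and f: "\<forall>v\<in>V - {r}. f v \<in> V" and d: "\<forall>v\<in>V - {r}. d (f v) < (d v :: nat)"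
  shows "strongly_connected (with_proj (parent_tree V r f))"
proof -
  let ?H = "with_proj (parent_tree V r f)"
  interpret wf_digraph ?H
    using f by unfold_locales (auto simp: parent_tree_def)
  have "v \<rightarrow>\<^sup>*\<^bsub>?H\<^esub> r \<and> r \<rightarrow>\<^sup>*\<^bsub>?H\<^esub> v" if "v \<in> V" for v
    using that
  proof (induction "d v" arbitrary: v rule: less_induct)
    case less
    show ?case
    proof (cases "v = r")
      case True
      then show ?thesis using r reachable_refl[of r] by (simp add: parent_tree_def)
    next
      case False
      then have v: "v \<in> V - {r}" using less by auto
      have "v \<rightarrow>\<^bsub>?H\<^esub> f v" "f v \<rightarrow>\<^bsub>?H\<^esub> v"
        using v by (auto simp: parent_tree_def)
      then show ?thesis
        using less(1)[of "f v"] v d f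
        by (meson adj_reachable_trans reachable_adj_trans)
    qed
  qed
  then have "\<forall>u\<in>V. \<forall>v\<in>V. u \<rightarrow>\<^sup>*\<^bsub>?H\<^esub> v"
    by (intro ballI) (rule reachable_trans[of _ r], simp_all del: with_proj_simps)
  moreover have "verts ?H = V"
    by (simp add: parent_tree_def)
  ultimately show ?thesis
    using r unfolding strongly_connected_def by auto
qed

text \<open>
  Induction on the rank of \<open>f\<close>: if the edge from \<open>v\<close> to \<open>f v\<close> were not the edge from \<open>v\<close> to
  its \<open>g\<close>-parent, then it would be the one from \<open>f v\<close> to its \<open>g\<close>-parent \<open>v\<close>. By induction \<open>v\<close>
  would also be the \<open>f\<close>-parent of \<open>f v\<close>, and the rank would decrease twice in returning to
  \<open>v\<close>.
\<close>

lemma inj_on_parent_tree: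
  assumes "pair_graph G"
  shows "inj_on (parent_tree (pverts G) r) (parent_functions G r)"
proof (rule inj_onI, rule ext)
  fix f g v
  let ?V = "pverts G - {r}"
  assume f: "f \<in> parent_functions G r" and g: "g \<in> parent_functions G r"
    and eq: "parent_tree (pverts G) r f = parent_tree (pverts G) r g"
  obtain d :: "_ \<Rightarrow> nat" where d: "\<forall>v\<in>?V. d (f v) < d v"
    using f by (auto simp: parent_functions_def grounded_def)
  have "v \<in> ?V \<Longrightarrow> f v = g v"
  proof (induction "d v" arbitrary: v rule: less_induct)
    case less
    have "(v, f v) \<in> parcs (parent_tree (pverts G) r f)"
      using less(2) by (auto simp: parent_tree_def)
    then have "(v, f v) \<in> parcs (parent_tree (pverts G) r g)"
      by (simp only: eq)
    then consider "f v = g v" | "f v \<in> ?V" "g (f v) = v"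
      by (auto simp: parent_tree_def)
    then show ?case
    proof cases
      case 2
      then have "f (f v) = v"
        using less d by auto
      then show ?thesis using 2 less d by (metis less_asym)
    qed
  qed
  then show "f v = g v"
    using f g by (cases "v \<in> ?V") (auto simp: parent_functions_def)
qed

lemma parent_tree_in_spanning_trees:
  assumes G: "pair_graph G" and r: "r \<in> pverts G" and f: "f \<in> parent_functions G r"
  shows "parent_tree (pverts G) r f \<in> undirected_spanning_trees G"
proof -
  let ?H = "parent_tree (pverts G) r f"
  interpret pair_graph G by fact
  obtain d :: "_ \<Rightarrow> nat" where d: "\<forall>v\<in>pverts G - {r}. d (f v) < d v"
    using f by (auto simp: parent_functions_def grounded_def)
  have arcs: "\<forall>v\<in>pverts G - {r}. (v, f v) \<in> parcs G \<and> (f v, v) \<in> parcs G"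
    using f pair_sym_arcs by (auto simp: parent_functions_def symmetric_def sym_def)
  then have fV: "\<forall>v\<in>pverts G - {r}. f v \<in> pverts G"
    by (auto dest: in_arcsD2)
  have "wf_digraph (with_proj ?H)"
    using fV by unfold_locales (auto simp: parent_tree_def)
  then have "spanning (with_proj ?H) (with_proj G)"
    using arcs wf_digraph_axioms
    by (auto simp: spanning_def subgraph_def parent_tree_def)
  moreover have sym: "symmetric (with_proj ?H)"
    by (auto simp: symmetric_def sym_def parent_tree_def)
  ultimately show ?thesis
    using parent_tree_strongly_connected[OF r fV d] parent_tree_acyclic[OF d]
    by (simp add: undirected_spanning_trees_def connected_symmetric_iff)
qed

text \<open>
  The rank is the distance to \<open>r\<close>, and a parent is any neighbour nearer to \<open>r\<close>. The resulting
  tree already connects everything, so an edge of \<open>H\<close> outside it would close a cycle with the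
  path of the tree between its ends.
\<close>

lemma spanning_tree_is_parent_tree:
  assumes G: "pair_graph G" and r: "r \<in> pverts G" and H: "H \<in> undirected_spanning_trees G"
  shows "H \<in> parent_tree (pverts G) r ` parent_functions G r"
proof -
  interpret G: pair_graph G by fact
  have V: "pverts H = pverts G" and sub: "parcs H \<subseteq> parcs G" and wf: "wf_digraph (with_proj H)"
    and sym: "symmetric (with_proj H)" and conn: "strongly_connected (with_proj H)"
    and acyc: "\<And>p. pre_digraph.cycle (with_proj H) p \<Longrightarrow> length p < 3"
    using H connected_symmetric_iff[of H]
    by (auto simp: undirected_spanning_trees_def spanning_def subgraph_def not_le)
  interpret H: wf_digraph "with_proj H" by (fact wf)
  let ?V = "pverts G - {r}"
  define d where "d v = (LEAST l. \<exists>p. H.awalk v p r \<and> length p = l)" for v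
  have step: "\<exists>w. (v, w) \<in> parcs H \<and> d w < d v" if v: "v \<in> ?V" for v
  proof -
    have "v \<rightarrow>\<^sup>*\<^bsub>with_proj H\<^esub> r"
      using conn v r V by (auto simp: strongly_connected_def)
    then obtain p0 where "H.awalk v p0 r" by (auto simp: H.reachable_awalk)
    then have "\<exists>l p. H.awalk v p r \<and> length p = l" by blast
    from LeastI_ex[OF this] obtain p where p: "H.awalk v p r" "length p = d v"
      by (auto simp: d_def)
    with v obtain e q where q: "p = e # q" by (cases p) (auto simp: H.awalk_Nil_iff)
    then have e: "e \<in> parcs H" "fst e = v" "H.awalk (snd e) q r"
      using p by (auto simp: H.awalk_Cons_iff)
    then have "d (snd e) \<le> length q"
      unfolding d_def by (intro Least_le) auto
    then show ?thesis using e q p(2) by (intro exI[of _ "snd e"]) auto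
  qed
  define f where "f v = (if v \<in> ?V then SOME w. (v, w) \<in> parcs H \<and> d w < d v else v)" for v
  have f: "(v, f v) \<in> parcs H \<and> d (f v) < d v" if "v \<in> ?V" for v
    using someI_ex[OF step[OF that]] that by (simp add: f_def)
  have fpar: "f \<in> parent_functions G r"
    using f sub by (auto simp: parent_functions_def grounded_def f_def)
  let ?T = "parent_tree (pverts G) r f"
  have TH: "parcs ?T \<subseteq> parcs H"
    using f sym by (auto simp: parent_tree_def symmetric_def sym_def)
  interpret T: wf_digraph "with_proj ?T"
    using parent_tree_in_spanning_trees[OF G r fpar]
    by (auto simp: undirected_spanning_trees_def spanning_def subgraph_def)
  have "parcs H \<subseteq> parcs ?T"
  proof (rule subrelI, rule ccontr)
    fix a b assume ab: "(a, b) \<in> parcs H" "(a, b) \<notin> parcs ?T"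
    have ba: "(b, a) \<notin> parcs ?T" using ab(2) by (auto simp: parent_tree_def)
    have neq: "a \<noteq> b" using ab(1) sub G.pair_no_loops by force
    have "a \<in> pverts G" "b \<in> pverts G" using ab(1) sub by (auto dest: G.in_arcsD1 G.in_arcsD2)
    then have "b \<rightarrow>\<^sup>*\<^bsub>with_proj ?T\<^esub> a"
      using parent_tree_in_spanning_trees[OF G r fpar] connected_symmetric_iff[of ?T]
      by (auto simp: undirected_spanning_trees_def strongly_connected_def parent_tree_def)
    then obtain p where p: "T.apath b p a" by (auto simp: T.reachable_apath)
    \<comment> \<open>The path has at least two arcs, hence the cycle that it forms with the extra edge at least three.\<close>
    have "p \<noteq> []" using p neq by (auto simp: T.apath_Nil_iff)
    moreover have "length p \<noteq> 1"
      using p ba by (cases p) (auto simp: T.apath_simps)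
    ultimately have len: "2 \<le> length p" by (cases p) (auto simp: Suc_le_eq)
    have "set p \<subseteq> parcs ?T" "pcas b p a" "distinct (pawalk_verts b p)"
      using p by (simp_all add: T.apath_def T.awalk_def cas_with_proj_eq awalk_verts_with_proj_eq)
    then have "H.awalk a ((a, b) # p) a" "distinct (tl (pawalk_verts a ((a, b) # p)))"
      using ab(1) TH H.wellformed[of "(a, b)"] by (auto simp: H.awalk_def cas_with_proj_eq)
    then have "H.cycle ((a, b) # p)"
      by (auto simp: H.cycle_def awalk_verts_with_proj_eq)
    from acyc[OF this] len show False by simp
  qed
  then have "parcs H = parcs ?T" "pverts H = pverts ?T"
    using TH V by (auto simp only: parent_tree_def pair_pre_digraph.simps)
  then have "H = ?T"
    by simp
  then show ?thesis using fpar by blast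
qed

lemma card_undirected_spanning_trees:
  assumes "pair_graph G" "r \<in> pverts G"
  shows "card (undirected_spanning_trees G) = card (parent_functions G r)"
proof -
  have "parent_tree (pverts G) r ` parent_functions G r = undirected_spanning_trees G"
    using parent_tree_in_spanning_trees[OF assms] spanning_tree_is_parent_tree[OF assms] by blast
  then show ?thesis
    using card_image[OF inj_on_parent_tree[OF assms(1)]] by metis
qed

section \<open>The matrix-tree theorem\<close>

text \<open>
  The points of \<open>V\<close> from which \<open>r\<close> is never reached are closed under \<open>f\<close> and under preimages.
  If there were none, the number of steps to \<open>r\<close> would be a rank.
\<close>

lemma not_grounded_imp_trapped:
  assumes root: "f r = r" "r \<notin> V" and V: "\<forall>v\<in>V. f v \<in> insert r V" and ng: "\<not> grounded V f"
  obtains C where "C \<subseteq> V" "C \<noteq> {}" "\<forall>v\<in>V. f v \<in> C \<longleftrightarrow> v \<in> C"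
proof
  define C where "C = {v \<in> V. \<forall>i. (f ^^ i) v \<noteq> r}"
  show "C \<subseteq> V" by (auto simp: C_def)
  have shift: "(f ^^ Suc i) v = (f ^^ i) (f v)" for i v by (simp add: funpow_swap1)
  show "\<forall>v\<in>V. f v \<in> C \<longleftrightarrow> v \<in> C"
  proof
    fix v assume v: "v \<in> V"
    have "(\<forall>i. (f ^^ i) v \<noteq> r) \<longleftrightarrow> (\<forall>i. (f ^^ i) (f v) \<noteq> r)"
    proof (intro iffI allI)
      show "(f ^^ i) (f v) \<noteq> r" if "\<forall>i. (f ^^ i) v \<noteq> r" for i
        using that shift[of i v] by metis
      show "(f ^^ i) v \<noteq> r" if "\<forall>i. (f ^^ i) (f v) \<noteq> r" for i
        using that shift v root by (cases i) auto
    qed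
    moreover have "f v \<in> V" if "\<forall>i. (f ^^ i) (f v) \<noteq> r"
      using that[rule_format, of 0] V v by auto
    ultimately show "f v \<in> C \<longleftrightarrow> v \<in> C" using v by (auto simp: C_def)
  qed
  show "C \<noteq> {}"
  proof
    assume "C = {}"
    then have ex: "\<exists>i. (f ^^ i) v = r" if "v \<in> V" for v using that by (auto simp: C_def)
    define d where "d v = (LEAST i. (f ^^ i) v = r)" for v
    have "d (f v) < d v" if v: "v \<in> V" for v
    proof -
      have *: "(f ^^ d v) v = r" unfolding d_def using ex[OF v] by (rule LeastI_ex)
      then obtain i where i: "d v = Suc i" using v root by (cases "d v") auto
      have "d (f v) \<le> i" unfolding d_def
        by (rule Least_le) (use * shift i in metis)
      then show ?thesis using i by simp
    qed
    then show False using ng by (auto simp: grounded_def)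
  qed
qed

text \<open>
  The row of \<open>i\<close> is \<open>e i - e (f i)\<close>, with \<open>e\<close> the standard basis, where \<open>e n\<close> of the root \<open>n\<close>
  is dropped. With a decreasing rank only the identity contributes to the Leibniz sum: a point
  of least rank among those moved by a permutation would have to be sent to its parent, which
  is then moved too. Without one, the indicator of a trapped set is in the kernel.
\<close>

lemma det_parent_matrix:
  fixes f :: "nat \<Rightarrow> nat"
  assumes f: "\<forall>i<n. f i \<le> n" "f n = n"
  shows "det (mat n n (\<lambda>(i, j). (if j = i then 1 else 0) - (if j = f i then 1 else 0))) =
    (if grounded {..<n} f then 1 else (0 :: 'a :: field))"
    (is "det ?M = _")
proof (cases "grounded {..<n} f")
  case True
  then obtain d :: "nat \<Rightarrow> nat" where d: "\<And>i. i < n \<Longrightarrow> d (f i) < d i"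
    by (auto simp: grounded_def)
  have zero: "(\<Prod>i = 0..<n. ?M $$ (i, p i)) = 0" if p: "p permutes {0..<n}" "p \<noteq> id" for p
  proof -
    have pn: "p i < n" if "i < n" for i
      using permutes_in_image[OF p(1), of i] that by auto
    obtain i0 where i0: "p i0 \<noteq> i0" using p(2) by (auto simp: fun_eq_iff)
    obtain i where i: "p i \<noteq> i" and min: "\<And>j. p j \<noteq> j \<Longrightarrow> d i \<le> d j"
      using arg_min_nat_lemma[of "\<lambda>i. p i \<noteq> i" i0 d] i0 by blast
    have "i < n" using i p(1) by (metis atLeast0LessThan lessThan_iff permutes_not_in)
    have "p i \<noteq> f i"
    proof
      assume eq: "p i = f i"
      have "p (f i) \<noteq> f i"
        using i eq permutes_inj[OF p(1)] by (metis injD)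
      then show False using min[of "f i"] d[OF \<open>i < n\<close>] by simp
    qed
    then have "?M $$ (i, p i) = 0" using i \<open>i < n\<close> pn by auto
    then show ?thesis using \<open>i < n\<close> by (intro prod_zero) auto
  qed
  have "det ?M = (\<Sum>p\<in>{p. p permutes {0..<n}}. signof p * (\<Prod>i = 0..<n. ?M $$ (i, p i)))"
    by (rule det_def') simp
  also have "\<dots> = (\<Sum>p\<in>{id}. signof p * (\<Prod>i = 0..<n. ?M $$ (i, p i)))"
    using zero by (intro sum.mono_neutral_right) (auto simp: finite_permutations permutes_id)
  also have "\<dots> = 1"
  proof -
    have "f i \<noteq> i" if "i < n" for i using d[OF that] by auto
    then show ?thesis by (auto intro!: prod.neutral) metis
  qed
  finally show ?thesis using True by simp
next
  case False
  then obtain C where C: "C \<subseteq> {..<n}" "C \<noteq> {}" "\<forall>v\<in>{..<n}. f v \<in> C \<longleftrightarrow> v \<in> C"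
    using not_grounded_imp_trapped[of f n "{..<n}"] f
    by (metis insert_iff lessThan_iff less_irrefl order_le_less)
  define x :: "'a vec" where "x = vec n (\<lambda>j. if j \<in> C then 1 else 0)"
  have "?M *\<^sub>v x = 0\<^sub>v n"
  proof (rule eq_vecI)
    fix i assume "i < dim_vec (0\<^sub>v n :: 'a vec)"
    then have i: "i < n" by simp
    have "(?M *\<^sub>v x) $ i = (\<Sum>j = 0..<n. ((if j = i then 1 else 0) - (if j = f i then 1 else 0)) *
        (if j \<in> C then 1 else 0))"
      using i by (simp add: scalar_prod_def x_def)
    also have "\<dots> = (\<Sum>j = 0..<n. (if j = i then if j \<in> C then 1 else 0 else 0)) -
        (\<Sum>j = 0..<n. (if j = f i then if j \<in> C then 1 else 0 else 0))"
      by (subst sum_subtractf[symmetric]) (auto intro!: sum.cong)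
    also have "\<dots> = (if i \<in> C then 1 else 0) - (if f i \<in> C then 1 else 0)"
      using i C(1) by (subst (1 2) sum.delta) auto
    also have "\<dots> = 0" using C(3) i by auto
    finally show "(?M *\<^sub>v x) $ i = 0\<^sub>v n $ i" using i by simp
  qed (simp add: x_def)
  moreover have "x \<noteq> 0\<^sub>v n"
  proof
    assume "x = 0\<^sub>v n"
    obtain j where "j \<in> C" using C(2) by auto
    then have "x $ j = 1" "j < n" using C(1) by (auto simp: x_def)
    with \<open>x = 0\<^sub>v n\<close> show False by simp
  qed
  moreover have "x \<in> carrier_vec n" by (simp add: x_def)
  ultimately have "det ?M = 0"
    using det_0_iff_vec_prod_zero_field[of ?M n] by auto
  then show ?thesis using False by simp
qed

text \<open>
  The index \<open>n\<close> is the root, whose row and column are deleted. Row \<open>i\<close> is the sum over \<open>u\<close> of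
  \<open>w i u\<close> times the row \<open>e i - e u\<close>, so multilinearity of the determinant gives a sum over all
  choices of \<open>u = f i\<close>.
\<close>

lemma det_weighted_laplacian:
  fixes w :: "nat \<Rightarrow> nat \<Rightarrow> 'a :: field"
  shows "det (mat n n (\<lambda>(i, j). (if j = i then \<Sum>u\<le>n. w i u else 0) - w i j)) =
    (\<Sum>f | (\<forall>i<n. f i \<le> n) \<and> (\<forall>i\<ge>n. f i = i) \<and> grounded {..<n} f. \<Prod>i<n. w i (f i))"
    (is "det ?L = _")
proof -
  let ?F = "{f. (\<forall>i\<in>{0..<n}. f i \<in> {..n}) \<and> (\<forall>i. i \<notin> {0..<n} \<longrightarrow> f i = i)}"
  define e :: "nat \<Rightarrow> nat \<Rightarrow> 'a vec" where
    "e i u = vec n (\<lambda>j. (if j = i then 1 else 0) - (if j = u then 1 else 0))" for i u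
  define a where "a i u = w i u \<cdot>\<^sub>v e i u" for i u
  have a: "a \<in> {0..<n} \<rightarrow> {..n} \<rightarrow> carrier_vec n" by (auto simp: a_def e_def)
  have "?L = mat\<^sub>r n n (\<lambda>i. finsum_vec TYPE('a) n (a i) {..n})"
  proof (rule eq_matI, goal_cases)
    case (1 i j)
    then have ij: "i < n" "j < n" by auto
    have "finsum_vec TYPE('a) n (a i) {..n} $ j = (\<Sum>u\<le>n. a i u $ j)"
      using ij a by (intro index_finsum_vec) auto
    also have "\<dots> = (\<Sum>u\<le>n. (if j = i then w i u else 0) - (if u = j then w i u else 0))"
      using ij by (intro sum.cong) (auto simp: a_def e_def)
    also have "\<dots> = (if j = i then \<Sum>u\<le>n. w i u else 0) - w i j"
      using ij by (auto simp: sum_subtractf)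
    finally show ?case using ij by (simp)
  qed simp_all
  then have "det ?L = (\<Sum>f\<in>?F. det (mat\<^sub>r n n (\<lambda>i. a i (f i))))"
    by (simp only: det_linear_rows_sum[OF finite_atMost a])
  also have "\<dots> = (\<Sum>f\<in>?F. (\<Prod>i<n. w i (f i)) * (if grounded {..<n} f then 1 else 0))"
  proof (rule sum.cong[OF refl])
    fix f assume f: "f \<in> ?F"
    have "mat\<^sub>r n n (\<lambda>i. e i (f i)) =
        mat n n (\<lambda>(i, j). (if j = i then 1 else 0) - (if j = f i then 1 else 0))"
      by (rule eq_matI) (auto simp: e_def)
    then have "det (mat\<^sub>r n n (\<lambda>i. e i (f i))) = (if grounded {..<n} f then 1 else 0)"
      using det_parent_matrix[of n f, where ?'a = 'a] f by simp
    moreover have "det (mat\<^sub>r n n (\<lambda>i. a i (f i))) =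
        (\<Prod>i<n. w i (f i)) * det (mat\<^sub>r n n (\<lambda>i. e i (f i)))"
      unfolding a_def by (subst det_rows_mul) (auto simp: e_def atLeast0LessThan)
    ultimately show "det (mat\<^sub>r n n (\<lambda>i. a i (f i))) =
        (\<Prod>i<n. w i (f i)) * (if grounded {..<n} f then 1 else 0)" by simp
  qed
  also have "\<dots> = (\<Sum>f\<in>?F \<inter> {f. grounded {..<n} f}. \<Prod>i<n. w i (f i))"
    using finite_bounded_functions[of "{..n}" "{0..<n}"]
    by (subst sum.inter_restrict) (auto intro!: sum.cong)
  also have "?F \<inter> {f. grounded {..<n} f} =
      {f. (\<forall>i<n. f i \<le> n) \<and> (\<forall>i\<ge>n. f i = i) \<and> grounded {..<n} f}"
    by auto
  finally show ?thesis .
qed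

text \<open>
  The extra vertex \<open>N\<close> is joined to each vertex by an edge of weight \<open>x\<close>. The parent functions
  of the larger graph rooted at \<open>N\<close> contribute \<open>x\<close> to the power of the number of children of
  \<open>N\<close>; those with a single child \<open>r\<close> are the parent functions of \<open>G\<close> rooted at \<open>r\<close>. Every
  spanning tree is counted once for each of its \<open>N\<close> possible roots.
\<close>

lemma matrix_tree:
  fixes G :: "nat pair_pre_digraph" and p :: "complex poly"
  assumes G: "pair_graph G" and V: "pverts G = {0..<N}"
    and p: "\<And>x. det (mat N N (\<lambda>(i, j). (if j = i then x + of_nat (card {u. (i, u) \<in> parcs G}) else 0) -
        (if (i, j) \<in> parcs G then 1 else 0))) = poly p x"
  shows "of_nat (N * card (undirected_spanning_trees G)) = coeff p 1"
proof -
  interpret pair_graph G by fact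
  define F where "F = {f. (\<forall>i<N. f i \<le> N) \<and> (\<forall>i\<ge>N. f i = i) \<and> grounded {..<N} f}"
  define E where "E = {f. \<forall>i<N. f i = N \<or> (i, f i) \<in> parcs G}"
  define roots where "roots f = {i. i < N \<and> f i = N}" for f :: "nat \<Rightarrow> nat"
  define w :: "complex \<Rightarrow> nat \<Rightarrow> nat \<Rightarrow> complex" where
    "w x i u = (if u = N then x else if (i, u) \<in> parcs G then 1 else 0)" for x i u
  have arcs_lt: "i < N" "j < N" if "(i, j) \<in> parcs G" for i j
    using in_arcsD1[OF that] in_arcsD2[OF that] V by auto
  have finF: "finite F"
    by (rule finite_subset[OF _ finite_bounded_functions[of "{..N}" "{0..<N}"]]) (auto simp: F_def)
  have prod_w: "(\<Prod>i<N. w x i (f i)) = (if f \<in> E then x ^ card (roots f) else 0)" for x f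
  proof (cases "f \<in> E")
    case True
    then have "(\<Prod>i<N. w x i (f i)) = (\<Prod>i<N. if f i = N then x else 1)"
      by (intro prod.cong) (auto simp: w_def E_def)
    also have "\<dots> = (\<Prod>i\<in>roots f. x)"
      by (auto simp: prod.If_cases roots_def Int_def)
    finally show ?thesis using True by simp
  next
    case False
    then obtain i where "i < N" "w x i (f i) = 0" by (auto simp: w_def E_def)
    then have "(\<Prod>i<N. w x i (f i)) = 0" by (intro prod_zero) auto
    then show ?thesis using False by simp
  qed
  have "poly p x = poly (\<Sum>f\<in>F \<inter> E. monom 1 (card (roots f))) x" for x
  proof -
    have sum_w: "(\<Sum>u\<le>N. w x i u) = x + of_nat (card {u. (i, u) \<in> parcs G})" for i
    proof -
      have "(\<Sum>u\<le>N. w x i u) = w x i N + (\<Sum>u<N. w x i u)"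
        by (simp add: lessThan_Suc_atMost[symmetric])
      also have "(\<Sum>u<N. w x i u) = (\<Sum>u<N. if (i, u) \<in> parcs G then 1 else 0)"
        by (intro sum.cong) (auto simp: w_def)
      also have "\<dots> = of_nat (card ({..<N} \<inter> {u. (i, u) \<in> parcs G}))"
        by (simp add: sum.If_cases)
      also have "{..<N} \<inter> {u. (i, u) \<in> parcs G} = {u. (i, u) \<in> parcs G}"
        using arcs_lt by auto
      finally show ?thesis by (simp add: w_def)
    qed
    have "poly p x = det (mat N N (\<lambda>(i, j). (if j = i then \<Sum>u\<le>N. w x i u else 0) - w x i j))"
      unfolding p[symmetric] sum_w by (intro arg_cong[of _ _ det] eq_matI) (auto simp: w_def)
    also have "\<dots> = (\<Sum>f\<in>F. if f \<in> E then x ^ card (roots f) else 0)"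
      unfolding det_weighted_laplacian F_def by (intro sum.cong refl prod_w)
    finally show ?thesis
      unfolding poly_sum poly_monom by (simp add: sum.inter_restrict finF)
  qed
  then have "p = (\<Sum>f\<in>F \<inter> E. monom 1 (card (roots f)))"
    by (simp add: poly_eq_poly_eq_iff[symmetric] fun_eq_iff)
  then have "coeff p 1 = (\<Sum>f\<in>F \<inter> E. if card (roots f) = 1 then 1 else 0)"
    by (simp add: coeff_sum)
  also have "\<dots> = of_nat (card {f \<in> F \<inter> E. card (roots f) = 1})"
    using finF by (simp add: sum.If_cases Int_def)
  also have "{f \<in> F \<inter> E. card (roots f) = 1} = (\<Union>r\<in>{0..<N}. {f \<in> F \<inter> E. roots f = {r}})"
    by (auto simp: card_1_singleton_iff) (auto simp: roots_def)
  also have "card \<dots> = (\<Sum>r\<in>{0..<N}. card {f \<in> F \<inter> E. roots f = {r}})"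
    using finF by (intro card_UN_disjoint) auto
  also have "\<dots> = (\<Sum>r\<in>{0..<N}. card (undirected_spanning_trees G))"
  proof (rule sum.cong[OF refl])
    fix r assume r: "r \<in> {0..<N}"
    have roots_iff: "roots f = {r} \<longleftrightarrow> (\<forall>v<N. f v = N \<longleftrightarrow> v = r)" for f
    proof -
      have "roots f = {r} \<longleftrightarrow> (\<forall>v. v < N \<and> f v = N \<longleftrightarrow> v = r)"
        unfolding roots_def by blast
      then show ?thesis using r by auto
    qed
    have "bij_betw (\<lambda>f. f(r := r)) {f \<in> F \<inter> E. roots f = {r}} (parent_functions G r)"
    proof (rule bij_betw_byWitness[where f' = "\<lambda>g. g(r := N)"])
      show "\<forall>f\<in>{f \<in> F \<inter> E. roots f = {r}}. (f(r := r))(r := N) = f"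
        using r by (auto simp: roots_iff fun_eq_iff)
      show "\<forall>g\<in>parent_functions G r. (g(r := N))(r := r) = g"
        by (auto simp: parent_functions_def fun_eq_iff)
      show "(\<lambda>f. f(r := r)) ` {f \<in> F \<inter> E. roots f = {r}} \<subseteq> parent_functions G r"
      proof (rule image_subsetI)
        fix f assume f: "f \<in> {f \<in> F \<inter> E. roots f = {r}}"
        then obtain d :: "nat \<Rightarrow> nat" where d: "\<forall>v\<in>{..<N}. d (f v) < d v"
          by (auto simp: F_def grounded_def)
        have "(v, f v) \<in> parcs G" if "v < N" "v \<noteq> r" for v
          using f that by (auto simp: roots_iff E_def)
        moreover have "grounded ({0..<N} - {r}) (f(r := r))"
          unfolding grounded_def using d by (intro exI[of _ d]) auto
        ultimately show "f(r := r) \<in> parent_functions G r"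
          using f V by (auto simp: F_def E_def parent_functions_def)
      qed
      show "(\<lambda>g. g(r := N)) ` parent_functions G r \<subseteq> {f \<in> F \<inter> E. roots f = {r}}"
      proof (rule image_subsetI)
        fix g assume g: "g \<in> parent_functions G r"
        then obtain d :: "nat \<Rightarrow> nat" where d: "\<forall>v\<in>{0..<N} - {r}. d (g v) < d v"
          by (auto simp: parent_functions_def grounded_def V)
        have arc: "(v, g v) \<in> parcs G" if "v < N" "v \<noteq> r" for v
          using g that by (auto simp: parent_functions_def V)
        have lt: "g v < N" if "v < N" "v \<noteq> r" for v
          using arcs_lt arc[OF that] by blast
        have "grounded {..<N} (g(r := N))"
          unfolding grounded_def
        proof (intro exI[of _ "\<lambda>v. if v = N then 0 else Suc (d v)"] ballI)
          fix v assume "v \<in> {..<N}"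
          then show "(if (g(r := N)) v = N then 0 else Suc (d ((g(r := N)) v))) <
              (if v = N then 0 else Suc (d v))"
            using d lt by auto
        qed
        then show "g(r := N) \<in> {f \<in> F \<inter> E. roots f = {r}}"
          using g r lt arc by (auto simp: F_def E_def roots_iff parent_functions_def V less_imp_le
              dest: less_imp_neq)
      qed
    qed
    then show "card {f \<in> F \<inter> E. roots f = {r}} = card (undirected_spanning_trees G)"
      using card_undirected_spanning_trees[OF G, of r] r V by (simp add: bij_betw_same_card)
  qed
  finally show ?thesis by simp
qed

section \<open>Circulant matrices and circulant graphs\<close>

definition primitive_root_of_unity :: "nat \<Rightarrow> complex \<Rightarrow> bool" where
  "primitive_root_of_unity N \<omega> \<longleftrightarrow> 0 < N \<and> \<omega> ^ N = 1 \<and> inj_on (\<lambda>k. \<omega> ^ k) {..<N}"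

lemma primitive_root_of_unity_cis: "0 < N \<Longrightarrow> primitive_root_of_unity N (cis (2 * pi / N))"
proof -
  assume N: "0 < N"
  have "cis (2 * pi / N) ^ k = cis (2 * pi * real k / real N)" for k
    by (simp add: DeMoivre mult.commute)
  then show ?thesis
    using N bij_betw_roots_unity[OF N]
    by (simp add: primitive_root_of_unity_def bij_betw_def)
qed

lemma primitive_root_nonzero: "primitive_root_of_unity N \<omega> \<Longrightarrow> \<omega> \<noteq> 0"
  by (auto simp: primitive_root_of_unity_def power_0_left)

lemma power_mod_order: "\<omega> ^ N = 1 \<Longrightarrow> \<omega> ^ (a mod N) = (\<omega> :: 'a :: monoid_mult) ^ a"
  by (metis div_mult_mod_eq mult_1 power_add power_mult power_one mult.commute)

text \<open>
  In a circulant matrix the column \<open>j\<close> of row \<open>i\<close> is replaced by the offset \<open>d\<close> from \<open>i\<close> to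
  \<open>j\<close> modulo \<open>N\<close>; truncated subtraction forces the summand \<open>N\<close> in the inverse map.
\<close>

lemma bij_betw_rotate:
  assumes "i < (N :: nat)"
  shows "bij_betw (\<lambda>d. (i + d) mod N) {..<N} {..<N}"
    and "\<And>j. j < N \<Longrightarrow> (i + (j + N - i) mod N) mod N = j"
    and "\<And>d. d < N \<Longrightarrow> ((i + d) mod N + N - i) mod N = d"
proof -
  show *: "(i + (j + N - i) mod N) mod N = j" if "j < N" for j
    using assms that by (simp add: mod_add_right_eq)
  show **: "((i + d) mod N + N - i) mod N = d" if "d < N" for d
    using assms that by (cases "i + d < N") (simp_all add: mod_if)
  show "bij_betw (\<lambda>d. (i + d) mod N) {..<N} {..<N}"
    by (rule bij_betw_byWitness[where f' = "\<lambda>j. (j + N - i) mod N"]) (use assms * ** in auto)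
qed

text \<open>
  The characters \<open>i \<mapsto> \<omega>\<^sup>i\<^sup>m\<close> are eigenvectors of every circulant matrix. They form a matrix
  that is invertible because its product with the matrix of inverse characters is \<open>N\<close> times
  the identity.
\<close>

lemma det_circulant:
  assumes "primitive_root_of_unity N \<omega>"
  shows "det (mat N N (\<lambda>(i, j). c ((j + N - i) mod N))) = (\<Prod>m<N. \<Sum>d<N. c d * \<omega> ^ (d * m))"
proof -
  have N: "0 < N" and \<omega>: "\<omega> ^ N = 1" and inj: "inj_on (\<lambda>k. \<omega> ^ k) {..<N}"
    using assms by (auto simp: primitive_root_of_unity_def)
  have nz: "\<omega> \<noteq> 0" using N \<omega> by (auto simp: power_0_left)
  let ?C = "mat N N (\<lambda>(i, j). c ((j + N - i) mod N))"
  define \<mu> where "\<mu> m = (\<Sum>d<N. c d * \<omega> ^ (d * m))" for m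
  define F where "F = mat N N (\<lambda>(i, m). \<omega> ^ (i * m))"
  define F' where "F' = mat N N (\<lambda>(m, i). inverse \<omega> ^ (i * m))"
  define D where "D = mat N N (\<lambda>(i, m). if i = m then \<mu> m else 0)"
  have "?C * F = F * D"
  proof (rule eq_matI)
    fix i m assume "i < dim_row (F * D)" "m < dim_col (F * D)"
    then have im: "i < N" "m < N" by (auto simp: F_def D_def)
    have "(?C * F) $$ (i, m) = (\<Sum>j<N. c ((j + N - i) mod N) * \<omega> ^ (j * m))"
      using im by (simp add: F_def scalar_prod_def atLeast0LessThan)
    also have "\<dots> = (\<Sum>d<N. c (((i + d) mod N + N - i) mod N) * \<omega> ^ (((i + d) mod N) * m))"
      by (rule sum.reindex_bij_betw[OF bij_betw_rotate(1)[OF im(1)], symmetric])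
    also have "\<dots> = (\<Sum>d<N. \<omega> ^ (i * m) * (c d * \<omega> ^ (d * m)))"
    proof (rule sum.cong[OF refl])
      fix d assume "d \<in> {..<N}"
      moreover have "\<omega> ^ (((i + d) mod N) * m) = \<omega> ^ (i * m) * \<omega> ^ (d * m)"
        by (simp only: power_mult power_mod_order[OF \<omega>] power_add power_mult_distrib)
      ultimately show "c (((i + d) mod N + N - i) mod N) * \<omega> ^ (((i + d) mod N) * m) =
          \<omega> ^ (i * m) * (c d * \<omega> ^ (d * m))"
        using bij_betw_rotate(3)[OF im(1), of d] by simp
    qed
    also have "\<dots> = \<omega> ^ (i * m) * \<mu> m" by (simp add: \<mu>_def sum_distrib_left)
    also have "\<dots> = (F * D) $$ (i, m)"
      using im by (simp add: F_def D_def scalar_prod_def if_distrib[of "(*) _"] cong: if_cong)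
    finally show "(?C * F) $$ (i, m) = (F * D) $$ (i, m)" .
  qed (auto simp: F_def D_def)
  then have "det ?C * det F = det F * det D"
    by (metis (no_types, lifting) D_def F_def det_mult mat_carrier)
  moreover have "det F \<noteq> 0"
  proof -
    have "F * F' = of_nat N \<cdot>\<^sub>m 1\<^sub>m N"
    proof (rule eq_matI)
      fix i l assume "i < dim_row (of_nat N \<cdot>\<^sub>m 1\<^sub>m N :: complex mat)" "l < dim_col (of_nat N \<cdot>\<^sub>m 1\<^sub>m N :: complex mat)"
      then have il: "i < N" "l < N" by auto
      define \<zeta> where "\<zeta> = \<omega> ^ i * inverse \<omega> ^ l"
      have "(F * F') $$ (i, l) = (\<Sum>m<N. \<zeta> ^ m)"
        using il by (simp add: F_def F'_def scalar_prod_def atLeast0LessThan \<zeta>_def power_mult power_mult_distrib)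
      also have "\<dots> = (if i = l then of_nat N else 0)"
      proof (cases "i = l")
        case True
        then show ?thesis using nz by (simp add: \<zeta>_def power_inverse)
      next
        case False
        then have "\<zeta> \<noteq> 1"
          using inj il nz by (auto simp: \<zeta>_def power_inverse field_simps inj_on_def)
        moreover have "\<zeta> ^ N = 1"
          using \<omega> by (simp add: \<zeta>_def power_mult_distrib power_inverse flip: power_mult)
            (metis mult.commute power_mult power_one inverse_1 mult_1)
        ultimately show ?thesis using False by (simp add: geometric_sum)
      qed
      finally show "(F * F') $$ (i, l) = (of_nat N \<cdot>\<^sub>m 1\<^sub>m N) $$ (i, l)"
        using il by simp
    qed (auto simp: F_def F'_def)
    then have "det F * det F' = of_nat N ^ N"
      by (metis (no_types, lifting) F'_def F_def det_mult det_one det_smult index_one_mat(3) mat_carrier mult.right_neutral)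
    then show ?thesis using N by auto
  qed
  ultimately have "det ?C = det D" by simp
  also have "\<dots> = (\<Prod>m<N. \<mu> m)"
    by (subst det_upper_triangular[of _ N])
      (auto simp: D_def upper_triangular_def prod_list_diag_prod atLeast0LessThan)
  finally show ?thesis by (simp add: \<mu>_def)
qed

lemma circulant_graph_arcs_iff:
  assumes A: "\<And>a. a \<in> A \<Longrightarrow> 0 < a \<and> a < N"
  shows "(i, j) \<in> parcs (circulant_graph N A) \<longleftrightarrow>
    i < N \<and> j < N \<and> (j + N - i) mod N \<in> A \<union> (\<lambda>a. N - a) ` A"
proof (cases "i < N \<and> j < N")
  case True
  define d where "d = (j + N - i) mod N"
  have dN: "d < N" using True by (auto simp: d_def)
  have d: "[int d = int j - int i] (mod int N)"
  proof -
    have "int d = (int j + int N - int i) mod int N"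
      using True by (simp add: d_def zmod_int of_nat_diff)
    also have "int j + int N - int i = int j - int i + int N" by simp
    finally show ?thesis by (simp only: cong_def mod_add_self2 mod_mod_trivial)
  qed
  have plus: "[int j = int i + int a] (mod int N) \<longleftrightarrow> d = a" if "a < N" for a
  proof -
    have "[int j = int i + int a] (mod int N) \<longleftrightarrow> [int j - int i = int a] (mod int N)"
      by (simp add: cong_iff_dvd_diff algebra_simps)
    also have "\<dots> \<longleftrightarrow> [int d = int a] (mod int N)"
      using d by (meson cong_sym cong_trans)
    finally show ?thesis
      using that dN by (simp add: cong_def)
  qed
  have minus: "[int j = int i - int a] (mod int N) \<longleftrightarrow> d = N - a" if "0 < a" "a < N" for a
  proof -
    have "int i + int (N - a) = int i - int a + int N"
      using that by (simp add: of_nat_diff)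
    then have "[int j = int i - int a] (mod int N) \<longleftrightarrow> [int j = int i + int (N - a)] (mod int N)"
      by (simp only: cong_def mod_add_self2)
    then show ?thesis using plus[of "N - a"] that by simp
  qed
  have "(i, j) \<in> parcs (circulant_graph N A) \<longleftrightarrow> (\<exists>a\<in>A. d = a \<or> d = N - a)"
    using True A plus minus by (simp add: circulant_graph_def)
  then show ?thesis using True by (auto simp: d_def)
qed (auto simp: circulant_graph_def)

text \<open>
  All eigenvalues of the Laplacian are read off from the determinant of a circulant matrix.
  The constant character has eigenvalue \<open>0\<close>, so the coefficient of \<open>x\<close> in the product of the
  factors \<open>x + \<rho> m\<close> is the product of the other eigenvalues. The set \<open>D\<close> of offsets contains
  the jump \<open>N / 2\<close> only once.
\<close>

theorem spanning_trees_circulant_graph: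
  fixes A :: "nat set"
  assumes A: "\<And>a. a \<in> A \<Longrightarrow> 0 < a \<and> a < N" and \<omega>: "primitive_root_of_unity N \<omega>"
  defines "D \<equiv> A \<union> (\<lambda>a. N - a) ` A"
  shows "of_nat (N * card (undirected_spanning_trees (circulant_graph N A))) =
    (\<Prod>m = 1..<N. \<Sum>d\<in>D. 1 - \<omega> ^ (d * m))"
proof -
  let ?G = "circulant_graph N A"
  have N: "0 < N" using \<omega> by (simp add: primitive_root_of_unity_def)
  have D: "D \<subseteq> {..<N}" "0 \<notin> D" using A by (force simp: D_def)+
  have finD: "finite D" using D by (auto intro: finite_subset)
  define \<rho> where "\<rho> m = (\<Sum>d\<in>D. 1 - \<omega> ^ (d * m))" for m
  define c where "c x d = (if d = 0 then x + of_nat (card D) else 0) - (if d \<in> D then 1 else (0 :: complex))"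
    for x d
  have deg: "card {u. (i, u) \<in> parcs ?G} = card D" if i: "i < N" for i
  proof -
    have "bij_betw (\<lambda>d. (i + d) mod N) D {u. (i, u) \<in> parcs ?G}"
    proof (rule bij_betw_subset[OF bij_betw_rotate(1)[OF i] D(1)])
      show "(\<lambda>d. (i + d) mod N) ` D = {u. (i, u) \<in> parcs ?G}"
      proof (intro equalityI subsetI)
        fix u assume "u \<in> (\<lambda>d. (i + d) mod N) ` D"
        then show "u \<in> {u. (i, u) \<in> parcs ?G}"
          using i D bij_betw_rotate(3)[OF i] by (auto simp: circulant_graph_arcs_iff[OF A] D_def[symmetric])
      next
        fix u assume "u \<in> {u. (i, u) \<in> parcs ?G}"
        then show "u \<in> (\<lambda>d. (i + d) mod N) ` D"
          using bij_betw_rotate(2)[OF i, of u]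
          by (auto simp: circulant_graph_arcs_iff[OF A] D_def[symmetric] intro!: rev_image_eqI[of "(u + N - i) mod N"])
      qed
    qed
    then show ?thesis by (simp add: bij_betw_same_card)
  qed
  have "det (mat N N (\<lambda>(i, j). (if j = i then x + of_nat (card {u. (i, u) \<in> parcs ?G}) else 0) -
      (if (i, j) \<in> parcs ?G then 1 else 0))) = poly (\<Prod>m<N. [:\<rho> m, 1:]) x" for x
  proof -
    have zero_iff: "(j + N - i) mod N = 0 \<longleftrightarrow> j = i" if "i < N" "j < N" for i j
      using bij_betw_rotate(2)[OF that] that by auto
    have "mat N N (\<lambda>(i, j). (if j = i then x + of_nat (card {u. (i, u) \<in> parcs ?G}) else 0) -
        (if (i, j) \<in> parcs ?G then 1 else 0)) = mat N N (\<lambda>(i, j). c x ((j + N - i) mod N))"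
      by (rule eq_matI) (simp_all add: c_def deg zero_iff, simp add: circulant_graph_arcs_iff[OF A] D_def[symmetric])
    then have "det (mat N N (\<lambda>(i, j). (if j = i then x + of_nat (card {u. (i, u) \<in> parcs ?G}) else 0) -
        (if (i, j) \<in> parcs ?G then 1 else 0))) = (\<Prod>m<N. \<Sum>d<N. c x d * \<omega> ^ (d * m))"
      by (simp only: det_circulant[OF \<omega>])
    also have "\<dots> = (\<Prod>m<N. x + \<rho> m)"
    proof (rule prod.cong[OF refl])
      fix m
      have "(\<Sum>d<N. c x d * \<omega> ^ (d * m)) =
          (\<Sum>d<N. if d = 0 then x + of_nat (card D) else 0) - (\<Sum>d<N. if d \<in> D then \<omega> ^ (d * m) else 0)"
        by (subst sum_subtractf[symmetric]) (auto simp: c_def intro!: sum.cong)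
      also have "\<dots> = x + of_nat (card D) - (\<Sum>d\<in>D. \<omega> ^ (d * m))"
        using N D(1) by (simp add: sum.If_cases Int_absorb1)
      finally show "(\<Sum>d<N. c x d * \<omega> ^ (d * m)) = x + \<rho> m"
        by (simp add: \<rho>_def sum_subtractf)
    qed
    finally show ?thesis by (simp add: poly_prod add.commute)
  qed
  then have "of_nat (N * card (undirected_spanning_trees ?G)) = coeff (\<Prod>m<N. [:\<rho> m, 1:]) 1"
    using matrix_tree[OF pair_graph_circulant_graph[OF A]] by (simp add: circulant_graph_def)
  also have "(\<Prod>m<N. [:\<rho> m, 1:]) = [:\<rho> 0, 1:] * (\<Prod>m = 1..<N. [:\<rho> m, 1:])"
    using N by (simp add: prod.atLeast_Suc_lessThan atLeast0LessThan[symmetric])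
  also have "\<rho> 0 = 0" by (simp add: \<rho>_def)
  also have "coeff ([:0, 1:] * (\<Prod>m = 1..<N. [:\<rho> m, 1:])) 1 = (\<Prod>m = 1..<N. \<rho> m)"
    by (simp add: coeff_pCons poly_0_coeff_0[symmetric] poly_prod)
  finally show ?thesis by (simp add: \<rho>_def)
qed

section \<open>Products over Chebyshev nodes\<close>

text \<open>
  Homogenized factorization of \<open>z\<^sup>n - 1\<close>: both sides of the case \<open>y = 1\<close> are monic of degree
  \<open>n\<close> with the same \<open>n\<close> roots.
\<close>

lemma prod_diff_root_multiples:
  assumes "primitive_root_of_unity n \<omega>"
  shows "(\<Prod>k<n. z - \<omega> ^ k * y) = z ^ n - y ^ n"
proof (cases "y = 0")
  case False
  have n: "0 < n" and \<omega>: "\<omega> ^ n = 1" and inj: "inj_on (\<lambda>k. \<omega> ^ k) {..<n}"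
    using assms by (auto simp: primitive_root_of_unity_def)
  let ?R = "(\<lambda>k. \<omega> ^ k) ` {..<n}"
  define p :: "complex poly" where "p = (\<Prod>k<n. [:- (\<omega> ^ k), 1:])"
  define q :: "complex poly" where "q = monom 1 n - 1"
  have degp: "degree p = n"
    by (simp add: p_def degree_prod_sum_eq)
  moreover have "lead_coeff p = 1"
    unfolding p_def lead_coeff_prod by simp
  ultimately have lp: "coeff p n = 1" by simp
  have "p - q = 0"
  proof (rule ccontr)
    assume ne: "p - q \<noteq> 0"
    have "degree (p - q) \<le> n"
      using degp by (intro degree_diff_le) (auto simp: q_def intro!: degree_diff_le degree_monom_le)
    moreover have "coeff (p - q) n = 0"
      using n lp by (simp add: q_def)
    ultimately have "degree (p - q) < n"
      using ne by (metis le_neq_implies_less leading_coeff_0_iff)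
    moreover have "?R \<subseteq> {x. poly (p - q) x = 0}"
    proof
      fix x assume "x \<in> ?R"
      then obtain k where k: "k < n" "x = \<omega> ^ k" by auto
      have "poly p x = 0"
        using k by (auto simp: p_def poly_prod)
      moreover have "poly q x = 0"
        using k \<omega> by (simp add: q_def poly_monom power_mult[symmetric])
          (simp add: mult.commute[of k] power_mult)
      ultimately show "x \<in> {x. poly (p - q) x = 0}" by simp
    qed
    then have "card ?R \<le> degree (p - q)"
      using card_mono[OF poly_roots_finite[OF ne]] card_poly_roots_bound[OF ne] order_trans by blast
    then have "n \<le> degree (p - q)"
      by (simp add: card_image[OF inj])
    ultimately show False by simp
  qed
  then have "poly p (z / y) = poly q (z / y)" by simp
  then have "(\<Prod>k<n. z / y - \<omega> ^ k) = (z / y) ^ n - 1"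
    by (simp add: p_def q_def poly_prod poly_monom)
  then have "y ^ n * (\<Prod>k<n. z / y - \<omega> ^ k) = z ^ n - y ^ n"
    using False by (simp only: power_divide right_diff_distrib) simp
  also have "y ^ n * (\<Prod>k<n. z / y - \<omega> ^ k) = (\<Prod>k<n. y * (z / y - \<omega> ^ k))"
    by (simp add: prod.distrib)
  finally show ?thesis using False by (simp add: algebra_simps)
qed (use assms in \<open>simp add: primitive_root_of_unity_def\<close>)

text \<open>
  Multiplying each factor by \<open>- \<omega>\<^sup>k\<close> exchanges the roles of \<open>z\<close> and \<open>y\<close>; the product of the
  multipliers is the factorization itself at \<open>z = 0\<close> and \<open>y = 1\<close>.
\<close>

lemma prod_diff_inverse_root_multiples:
  assumes "primitive_root_of_unity n \<omega>"
  shows "(\<Prod>k<n. z - y / \<omega> ^ k) = z ^ n - y ^ n"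
proof -
  have nz: "\<omega> \<noteq> 0" and n: "0 < n"
    using assms by (auto simp: primitive_root_nonzero primitive_root_of_unity_def)
  have "(\<Prod>k<n. z - y / \<omega> ^ k) = (\<Prod>k<n. (y - \<omega> ^ k * z) / (0 - \<omega> ^ k * 1))"
    using nz by (intro prod.cong) (auto simp: field_simps)
  also have "\<dots> = (y ^ n - z ^ n) / (0 ^ n - 1 ^ n)"
    unfolding prod_dividef prod_diff_root_multiples[OF assms] ..
  finally show ?thesis using n by (simp add: power_0_left)
qed

text \<open>
  The identity \<open>T\<^sub>n (cos \<phi>) = cos (n \<phi>)\<close> with \<open>z = exp (i \<phi>)\<close>, in a form that needs no
  trigonometry.
\<close>

lemma chebyshev_T_Joukowski:
  fixes z :: "'a :: field_char_0"
  assumes "z \<noteq> 0"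
  shows "poly (chebyshev_T n) ((z + 1 / z) / 2) = (z ^ n + 1 / z ^ n) / 2"
proof (induction n rule: chebyshev_T.induct)
  case (3 m)
  have step: "(z + 1 / z) * ((z * a + 1 / (z * a)) / 2) - (a + 1 / a) / 2 =
      (z * (z * a) + 1 / (z * (z * a))) / 2" if "a \<noteq> 0" for a
    using assms that by (simp add: divide_simps) (simp add: algebra_simps)
  have "poly (chebyshev_T (Suc (Suc m))) ((z + 1 / z) / 2) =
      (z + 1 / z) * poly (chebyshev_T (Suc m)) ((z + 1 / z) / 2) - poly (chebyshev_T m) ((z + 1 / z) / 2)"
    by simp
  also have "\<dots> = (z ^ Suc (Suc m) + 1 / z ^ Suc (Suc m)) / 2"
    unfolding 3 power_Suc by (rule step) (use assms in simp)
  finally show ?case .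
qed (use assms in simp_all)

lemma Joukowski_surj:
  fixes x :: complex
  obtains z where "z \<noteq> 0" "x = (z + 1 / z) / 2"
proof
  define z where "z = x + csqrt (x\<^sup>2 - 1)"
  have *: "z * z - 2 * x * z + 1 = 0"
    using power2_csqrt[of "x\<^sup>2 - 1"] by (simp add: z_def power2_eq_square algebra_simps)
  then show "z \<noteq> 0" by auto
  with * show "x = (z + 1 / z) / 2" by (simp add: field_simps)
qed

text \<open>
  The points \<open>(y \<omega>\<^sup>k + 1 / (y \<omega>\<^sup>k)) / 2\<close> are the solutions of \<open>T\<^sub>n x = (y\<^sup>n + 1 / y\<^sup>n) / 2\<close>,
  even with multiplicity: after substituting \<open>x = (z + 1 / z) / 2\<close>, each linear factor splits
  into \<open>(z - y \<omega>\<^sup>k) (z - 1 / (y \<omega>\<^sup>k)) / (2 z)\<close>. The values \<open>y\<^sup>n = 1\<close> and \<open>y\<^sup>n = -1\<close> give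
  \<open>T\<^sub>n - 1\<close> and \<open>T\<^sub>n + 1\<close>, where roots may be double.
\<close>

lemma chebyshev_T_diff_factorization:
  assumes \<omega>: "primitive_root_of_unity n \<omega>" and y: "y \<noteq> 0"
  shows "poly (chebyshev_T n) x - (y ^ n + 1 / y ^ n) / 2 =
    2 ^ (n - 1) * (\<Prod>k<n. x - (y * \<omega> ^ k + 1 / (y * \<omega> ^ k)) / 2)"
proof -
  have nz: "\<omega> \<noteq> 0" and n: "0 < n"
    using \<omega> by (auto simp: primitive_root_nonzero primitive_root_of_unity_def)
  obtain z where z: "z \<noteq> 0" and x: "x = (z + 1 / z) / 2" by (rule Joukowski_surj)
  have "(\<Prod>k<n. x - (y * \<omega> ^ k + 1 / (y * \<omega> ^ k)) / 2) =
      (\<Prod>k<n. (z - \<omega> ^ k * y) * (z - (1 / y) / \<omega> ^ k) / (2 * z))"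
    using y z nz by (intro prod.cong) (auto simp: x field_simps)
  also have "\<dots> = (z ^ n - y ^ n) * (z ^ n - (1 / y) ^ n) / (2 * z) ^ n"
    by (simp add: prod_dividef prod.distrib prod_diff_root_multiples[OF \<omega>]
        prod_diff_inverse_root_multiples[OF \<omega>] del: divide_divide_eq_left)
  also have "2 ^ (n - 1) * \<dots> = (z ^ n - y ^ n) * (z ^ n - 1 / y ^ n) / (2 * z ^ n)"
    using n z by (cases n) (simp_all add: power_mult_distrib power_one_over field_simps)
  also have "\<dots> = (z ^ n + 1 / z ^ n) / 2 - (y ^ n + 1 / y ^ n) / 2"
    using y z by (simp add: field_simps)
  finally show ?thesis
    unfolding x chebyshev_T_Joukowski[OF z] by simp
qed

lemma prod_prod_mset_swap:
  "(\<Prod>x\<in>A. \<Prod>u\<in>#M. f x u) = (\<Prod>u\<in>#M. \<Prod>x\<in>A. (f x u :: 'a :: comm_monoid_mult))"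
  by (induction M) (simp_all add: prod.distrib)

lemma poly_prod_mset: "poly (\<Prod>u\<in>#M. f u) x = (\<Prod>u\<in>#M. poly (f u) x :: 'a :: comm_semiring_1)"
  by (induction M) simp_all

text \<open>
  This evaluates at the root \<open>a\<close> what remains of a polynomial after the factor \<open>x - a\<close> is
  removed.
\<close>

lemma poly_pderiv_root_cofactor:
  "poly (pderiv ([:- a, 1:] * r)) a = poly r (a :: 'a :: idom)"
  by (simp add: pderiv_mult pderiv_pCons del: mult_pCons_left)

text \<open>
  Both sides are the resultant of \<open>Q\<close> and \<open>T\<^sub>n - (y\<^sup>n + 1 / y\<^sup>n) / 2\<close>, up to normalization: a
  double product of differences between nodes and roots of \<open>Q\<close>, taken in the two possible
  orders.
\<close>

lemma prod_poly_chebyshev_nodes: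
  fixes Q :: "complex poly"
  assumes \<omega>: "primitive_root_of_unity n \<omega>" and y: "y \<noteq> 0"
  shows "(\<Prod>k<n. poly Q ((y * \<omega> ^ k + 1 / (y * \<omega> ^ k)) / 2)) =
    lead_coeff Q ^ n * ((- 1) ^ n / 2 ^ (n - 1)) ^ degree Q *
    (\<Prod>u\<in>#proots Q. poly (chebyshev_T n) u - (y ^ n + 1 / y ^ n) / 2)"
proof -
  define node where "node k = (y * \<omega> ^ k + 1 / (y * \<omega> ^ k)) / 2" for k
  have Q: "poly Q x = lead_coeff Q * (\<Prod>u\<in>#proots Q. x - u)" for x
    by (subst (1) complex_poly_decompose_multiset[symmetric]) (simp add: poly_prod_mset)
  have node: "(\<Prod>k<n. node k - u) =
      (- 1) ^ n / 2 ^ (n - 1) * (poly (chebyshev_T n) u - (y ^ n + 1 / y ^ n) / 2)" for u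
  proof -
    have "(\<Prod>k<n. node k - u) = (\<Prod>k<n. (- 1) * (u - node k))" by simp
    also have "\<dots> = (- 1) ^ n * (\<Prod>k<n. u - node k)"
      by (simp only: prod.distrib prod_constant card_lessThan)
    finally show ?thesis
      by (simp add: chebyshev_T_diff_factorization[OF \<omega> y] node_def)
  qed
  have "(\<Prod>k<n. poly Q (node k)) = lead_coeff Q ^ n * (\<Prod>k<n. \<Prod>u\<in>#proots Q. node k - u)"
    by (subst Q) (simp add: prod.distrib)
  also have "(\<Prod>k<n. \<Prod>u\<in>#proots Q. node k - u) = ((- 1) ^ n / 2 ^ (n - 1)) ^ degree Q *
      (\<Prod>u\<in>#proots Q. poly (chebyshev_T n) u - (y ^ n + 1 / y ^ n) / 2)"
    unfolding prod_prod_mset_swap node prod_mset.distrib prod_mset_constant size_proots_complex ..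
  finally show ?thesis by (simp add: node_def mult.assoc)
qed

text \<open>
  Removing the factor \<open>x - 1\<close> of the node \<open>k = 0\<close> from the factorization of \<open>T\<^sub>n - 1\<close> and
  evaluating the cofactor at \<open>1\<close> yields \<open>T\<^sub>n' 1 = n\<^sup>2\<close>.
\<close>

lemma prod_nontrivial_nodes_minus_1:
  assumes \<omega>: "primitive_root_of_unity n \<omega>"
  shows "(\<Prod>k = 1..<n. (\<omega> ^ k + 1 / \<omega> ^ k) / 2 - 1) = (- 1) ^ (n - 1) / 2 ^ (n - 1) * of_nat (n\<^sup>2)"
proof -
  define node where "node k = (\<omega> ^ k + 1 / \<omega> ^ k) / 2" for k
  define r where "r = [:2 ^ (n - 1):] * (\<Prod>k = 1..<n. [:- node k, 1:])"
  have n: "0 < n" using \<omega> by (simp add: primitive_root_of_unity_def)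
  have "poly (chebyshev_T n - [:1:]) x = poly ([:- 1, 1:] * r) x" for x
  proof -
    have "poly (chebyshev_T n - [:1:]) x = 2 ^ (n - 1) * (\<Prod>k<n. x - node k)"
      using chebyshev_T_diff_factorization[OF \<omega>, of 1 x] by (simp add: node_def)
    also have "(\<Prod>k<n. x - node k) = (x - 1) * (\<Prod>k = 1..<n. x - node k)"
      using n by (simp add: atLeast0LessThan[symmetric] prod.atLeast_Suc_lessThan node_def)
    finally show ?thesis by (simp add: r_def poly_prod algebra_simps)
  qed
  then have "chebyshev_T n - [:1:] = [:- 1, 1:] * r"
    by (simp only: poly_eq_poly_eq_iff[symmetric] fun_eq_iff) simp
  then have "poly r 1 = poly (pderiv (chebyshev_T n - [:1:])) 1"
    by (simp only: poly_pderiv_root_cofactor)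
  also have "\<dots> = of_nat (n\<^sup>2)"
    by (simp add: pderiv_diff pderiv_pCons poly_pderiv_chebyshev_T_1 del: of_nat_power)
  finally have "2 ^ (n - 1) * (\<Prod>k = 1..<n. 1 - node k) = of_nat (n\<^sup>2)"
    by (simp add: r_def poly_prod)
  moreover have "(\<Prod>k = 1..<n. node k - 1) = (- 1) ^ (n - 1) * (\<Prod>k = 1..<n. 1 - node k)"
  proof -
    have "(\<Prod>k = 1..<n. node k - 1) = (\<Prod>k = 1..<n. (- 1) * (1 - node k))" by simp
    then show ?thesis by (simp only: prod.distrib prod_constant card_atLeastLessThan)
  qed
  ultimately show ?thesis by (simp add: node_def field_simps)
qed

section \<open>The polynomial of the graph and its spanning trees\<close>

lemma lead_coeff_circulant_poly_diff:
  assumes k: "1 \<le> k" and s1: "1 \<le> s 1" and mono: "strict_mono_on {1..k} s"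
  shows "lead_coeff (circulant_poly s k - [:c:]) = - (2 ^ s k)"
proof -
  have sk: "1 \<le> s k" using s_pos[OF assms] k by simp
  have "coeff (chebyshev_T (s i) :: complex poly) (s k) = (if i = k then 2 ^ (s k - 1) else 0)"
    if "i \<in> {1..k}" for i
  proof (cases "i = k")
    case False
    then have "s i < s k" using that k strict_mono_onD[OF mono, of i k] by auto
    then show ?thesis
      using False chebyshev_T_coeff[of "s i"] by (auto intro!: coeff_eq_0)
  qed (simp add: chebyshev_T_coeff)
  then have "(\<Sum>i = 1..k. coeff (chebyshev_T (s i) :: complex poly) (s k)) = 2 ^ (s k - 1)"
    using k by simp
  moreover have "coeff [:a:] (s k) = 0" for a :: complex
    using sk by (cases "s k") auto
  ultimately show ?thesis
    unfolding degree_circulant_poly_diff[OF assms]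
    using sk by (simp add: circulant_poly_smult coeff_sum power_eq_if)
qed

text \<open>
  With \<open>z = \<omega>\<^sup>m\<close>, the sum on the right collects the contributions of the jumps \<open>s i\<close> and
  \<open>- s i\<close> to the Laplacian eigenvalue.
\<close>

lemma poly_circulant_poly_Joukowski:
  assumes "z \<noteq> 0"
  shows "poly (circulant_poly s k) ((z + 1 / z) / 2) =
    (\<Sum>i = 1..k. 2 - z ^ s i - 1 / z ^ s i) + 1"
proof -
  have "poly (circulant_poly s k) ((z + 1 / z) / 2) = of_nat (2 * k + 1) - (\<Sum>i = 1..k. z ^ s i + 1 / z ^ s i)"
    by (simp add: circulant_poly_smult poly_sum chebyshev_T_Joukowski[OF assms] sum_divide_distrib[symmetric])
  then show ?thesis
    by (simp add: sum_subtractf sum.distrib)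
qed

lemma poly_pderiv_circulant_poly_1:
  "poly (pderiv (circulant_poly s k - [:c:])) 1 = - 2 * of_nat (\<Sum>i = 1..k. (s i)\<^sup>2)"
  by (simp add: circulant_poly_smult pderiv_diff pderiv_smult pderiv_pCons
        higher_pderiv_sum[of 1, simplified] poly_sum poly_pderiv_chebyshev_T_1 del: of_nat_power)

lemma prod_split_even_odd:
  fixes f :: "nat \<Rightarrow> 'a :: comm_monoid_mult"
  assumes "0 < n"
  shows "(\<Prod>m = 1..<2 * n. f m) = (\<Prod>m = 1..<n. f (2 * m)) * (\<Prod>m<n. f (2 * m + 1))"
  using assms
proof (induction n rule: nat_induct_non_zero)
  case (Suc n)
  then show ?case by (simp add: atLeastLessThanSuc ac_simps)
qed (simp add: atLeastLessThanSuc numeral_2_eq_2)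

theorem theorem2:
  fixes k n :: nat and s :: "nat \<Rightarrow> nat"
  assumes "1 \<le> k"
    and "1 \<le> s 1"
    and "strict_mono_on {1..k} s"
    and "s k < n"
    and "Digraph_Component.connected (with_proj (circulant_graph (2 * n) (insert n (s ` {1..k}))))"
  defines "\<tau> \<equiv> card (undirected_spanning_trees (circulant_graph (2 * n) (insert n (s ` {1..k}))))"
    and "q \<equiv> (\<Sum>i = 1..k. (s i)\<^sup>2)"
    and "P \<equiv> circulant_poly s k"
  shows "of_nat \<tau> = of_nat n * 4 ^ (s k - 1) / of_nat q *
    (\<Prod>u\<in>#filter_mset (\<lambda>u. u \<noteq> 1) (proots (P - 1)). poly (chebyshev_T n) u - 1) *
    (\<Prod>v\<in>#proots (P + 1). poly (chebyshev_T n) v + 1)"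
proof -
  note s = assms(1-3)
  let ?S = "s k"
  define A where "A = insert n (s ` {1..k})"
  define \<omega> where "\<omega> = cis (2 * pi / real (2 * n))"
  define node where "node m = (\<omega> ^ m + 1 / \<omega> ^ m) / 2" for m
  define C where "C = (\<Prod>u\<in>#filter_mset (\<lambda>u. u \<noteq> 1) (proots (P - 1)). poly (chebyshev_T n) u - 1)"
  define B where "B = (\<Prod>v\<in>#proots (P + 1). poly (chebyshev_T n) v + 1)"
  define h where "h = ((- 1) ^ n / 2 ^ (n - 1) :: complex)"
  define K where "K = (- (2 ^ ?S)) ^ n * h ^ ?S"
  have n: "0 < n" using assms(4) by simp
  have sk: "1 \<le> ?S" using s_pos[OF s] s(1) by simp
  have s_bounds: "0 < s i" "s i < n" if "i \<in> {1..k}" for i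
    using s_pos[OF s that] strict_mono_on_leD[OF s(3), of i k] that assms(4) by auto
  have s_inj: "inj_on s {1..k}"
    by (rule strict_mono_on_imp_inj_on[OF s(3)])

  have \<omega>: "primitive_root_of_unity (2 * n) \<omega>"
    unfolding \<omega>_def using n by (intro primitive_root_of_unity_cis) simp
  have nz: "\<omega> \<noteq> 0" by (rule primitive_root_nonzero[OF \<omega>])
  have \<omega>_n: "\<omega> ^ n = - 1"
  proof -
    have "(\<omega> ^ n)\<^sup>2 = 1"
      using \<omega> by (simp add: primitive_root_of_unity_def power_mult[symmetric] mult.commute)
    moreover have "\<omega> ^ n \<noteq> \<omega> ^ 0"
      using \<omega> n by (auto simp: primitive_root_of_unity_def simp del: power_0 dest: inj_onD)
    ultimately show ?thesis by (simp add: power2_eq_1_iff)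
  qed
  have \<omega>2: "primitive_root_of_unity n (\<omega>\<^sup>2)"
  proof -
    have "inj_on (\<lambda>m. \<omega> ^ (2 * m)) {..<n}"
    proof (rule inj_onI)
      fix x y assume "x \<in> {..<n}" "y \<in> {..<n}" "\<omega> ^ (2 * x) = \<omega> ^ (2 * y)"
      then have "2 * x = 2 * y"
        using \<omega> inj_onD[of "\<lambda>m. \<omega> ^ m" "{..<2 * n}" "2 * x" "2 * y"]
        by (simp add: primitive_root_of_unity_def)
      then show "x = y" by simp
    qed
    then show ?thesis
      using \<omega> n by (simp add: primitive_root_of_unity_def power_mult)
  qed

  have poly_P1: "P - 1 = P - [:1:]" "P + 1 = P - [:- 1:]"
    by (simp_all add: one_pCons)
  have q_pos: "0 < q"
    unfolding q_def using s by (intro sum_pos2[of _ 1]) auto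
  have P1_root: "poly (P - 1) 1 = 0"
    by (simp add: P_def circulant_poly_smult poly_sum poly_chebyshev_T_1)

  \<comment> \<open>The jump \<open>n\<close> contributes \<open>1 - (-1)\<^sup>m\<close>; the constant \<open>1\<close> is part of \<open>P\<close>.\<close>
  have eigen: "(\<Sum>d\<in>A \<union> (\<lambda>a. 2 * n - a) ` A. 1 - \<omega> ^ (d * m)) = poly P (node m) - (- 1) ^ m" for m
  proof -
    let ?g = "\<lambda>d. 1 - \<omega> ^ (d * m)"
    have "A \<union> (\<lambda>a. 2 * n - a) ` A = insert n (s ` {1..k} \<union> (\<lambda>i. 2 * n - s i) ` {1..k})"
      by (auto simp: A_def)
    moreover have low: "\<forall>d\<in>s ` {1..k}. d < n" and high: "\<forall>d\<in>(\<lambda>i. 2 * n - s i) ` {1..k}. n < d"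
      using s_bounds(2) by (simp_all add: less_diff_conv)
    moreover have "n \<notin> s ` {1..k} \<union> (\<lambda>i. 2 * n - s i) ` {1..k}"
      using low high less_irrefl by blast
    moreover have "s ` {1..k} \<inter> (\<lambda>i. 2 * n - s i) ` {1..k} = {}"
      using low high less_asym by blast
    moreover have "inj_on (\<lambda>i. 2 * n - s i) {1..k}"
    proof (rule inj_onI)
      fix i j assume "i \<in> {1..k}" "j \<in> {1..k}" "2 * n - s i = 2 * n - s j"
      moreover from this have "s i = s j"
        using s_bounds(2)[of i] s_bounds(2)[of j] by linarith
      ultimately show "i = j" using s_inj by (auto dest: inj_onD)
    qed
    ultimately have "(\<Sum>d\<in>A \<union> (\<lambda>a. 2 * n - a) ` A. ?g d) =
        ?g n + ((\<Sum>i = 1..k. ?g (s i)) + (\<Sum>i = 1..k. ?g (2 * n - s i)))"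
      by (simp add: sum.union_disjoint sum.reindex s_inj del: One_nat_def)
    also have "\<dots> = 1 - (- 1) ^ m + (\<Sum>i = 1..k. 2 - (\<omega> ^ m) ^ s i - 1 / (\<omega> ^ m) ^ s i)"
    proof -
      have "?g (s i) + ?g (2 * n - s i) = 2 - (\<omega> ^ m) ^ s i - 1 / (\<omega> ^ m) ^ s i" if "i \<in> {1..k}" for i
      proof -
        have "\<omega> ^ (2 * n - s i) * \<omega> ^ s i = 1"
          using \<omega> s_bounds[OF that] by (simp add: primitive_root_of_unity_def flip: power_add)
        then have "\<omega> ^ (2 * n - s i) = 1 / \<omega> ^ s i"
          using nz by (simp add: eq_divide_eq)
        then have "\<omega> ^ ((2 * n - s i) * m) = 1 / (\<omega> ^ m) ^ s i"
          by (simp add: power_mult power_divide) (simp flip: power_mult add: mult.commute)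
        moreover have "\<omega> ^ (s i * m) = (\<omega> ^ m) ^ s i"
          by (simp flip: power_mult add: mult.commute)
        ultimately show ?thesis by simp
      qed
      then have "(\<Sum>i = 1..k. ?g (s i)) + (\<Sum>i = 1..k. ?g (2 * n - s i)) =
          (\<Sum>i = 1..k. 2 - (\<omega> ^ m) ^ s i - 1 / (\<omega> ^ m) ^ s i)"
        unfolding sum.distrib[symmetric] by (rule sum.cong[OF refl])
      moreover have "?g n = 1 - (- 1) ^ m"
        by (simp add: power_mult \<omega>_n)
      ultimately show ?thesis by simp
    qed
    finally show ?thesis
      using nz by (simp add: P_def node_def poly_circulant_poly_Joukowski)
  qed

  have A_bounds: "0 < a \<and> a < 2 * n" if "a \<in> A" for a
  proof -
    have "s i < 2 * n" if "i \<in> {1..k}" for i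
      using s_bounds(2)[OF that] by simp
    then show ?thesis
      using that n s_bounds(1) by (auto simp: A_def)
  qed
  have "of_nat (2 * n * \<tau>) = (\<Prod>m = 1..<2 * n. poly P (node m) - (- 1) ^ m)"
    unfolding eigen[symmetric] \<tau>_def A_def[symmetric]
    by (rule spanning_trees_circulant_graph[OF A_bounds \<omega>])
  also have "\<dots> = (\<Prod>m = 1..<n. poly (P - 1) (node (2 * m))) * (\<Prod>m<n. poly (P + 1) (node (2 * m + 1)))"
    unfolding prod_split_even_odd[OF n] by simp
  finally have \<tau>: "of_nat (2 * n * \<tau>) =
    (\<Prod>m = 1..<n. poly (P - 1) (node (2 * m))) * (\<Prod>m<n. poly (P + 1) (node (2 * m + 1)))" .

  have odd: "(\<Prod>m<n. poly (P + 1) (node (2 * m + 1))) = K * B"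
  proof -
    have "degree (P + 1) = ?S" "lead_coeff (P + 1) = - (2 ^ ?S)"
      unfolding poly_P1 unfolding P_def by (rule degree_circulant_poly_diff[OF s] lead_coeff_circulant_poly_diff[OF s])+
    then show ?thesis
      using prod_poly_chebyshev_nodes[OF \<omega>2 nz, of "P + 1"]
      by (simp add: node_def K_def B_def h_def \<omega>_n power_mult)
  qed

  \<comment> \<open>The root \<open>1\<close> of \<open>P - 1\<close> and the node of index \<open>0\<close> coincide. Passing to the cofactor \<open>R\<close>
  makes the exchange of products available for all nodes; the value \<open>R 1 = -2 q\<close> at the extra
  node is then divided out.\<close>
  have even: "2 * of_nat q * (\<Prod>m = 1..<n. poly (P - 1) (node (2 * m))) = of_nat (n\<^sup>2) * (K * C)"
  proof -
    have "[:- 1, 1:] dvd P - 1"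
      using P1_root by (simp only: poly_eq_0_iff_dvd)
    then obtain R where R: "P - 1 = [:- 1, 1:] * R"
      by (rule dvdE)
    have R1: "poly R 1 = - 2 * of_nat q"
      using poly_pderiv_root_cofactor[of 1 R] poly_pderiv_circulant_poly_1[of s k 1]
      by (simp only: R[symmetric] poly_P1 P_def[symmetric] q_def)
    then have R0: "R \<noteq> 0" and "poly R 1 \<noteq> 0" using q_pos by auto
    have deg: "degree (P - 1) = ?S" and lead: "lead_coeff (P - 1) = - (2 ^ ?S)"
      unfolding poly_P1 unfolding P_def by (rule degree_circulant_poly_diff[OF s] lead_coeff_circulant_poly_diff[OF s])+
    have leadR: "lead_coeff R = - (2 ^ ?S)"
      using lead unfolding R lead_coeff_mult by simp
    have "degree (P - 1) = 1 + degree R"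
      unfolding R using R0 by (subst degree_mult_eq) auto
    then have degR: "Suc (degree R) = ?S" using deg by simp
    have "proots (P - 1) = {#1#} + proots R"
      unfolding R using R0 by (subst proots_mult) auto
    moreover have "filter_mset (\<lambda>u. u \<noteq> 1) (proots R) = proots R"
      using \<open>poly R 1 \<noteq> 0\<close> R0 by (intro filter_mset_cong0[THEN trans, OF _ filter_mset_True]) auto
    ultimately have C: "C = (\<Prod>u\<in>#proots R. poly (chebyshev_T n) u - 1)"
      by (simp add: C_def)
    have "poly R 1 * (\<Prod>m = 1..<n. poly R (node (2 * m))) = (\<Prod>m<n. poly R (node (2 * m)))"
      using n by (simp add: atLeast0LessThan[symmetric] prod.atLeast_Suc_lessThan node_def)
    also have "\<dots> = (- (2 ^ ?S)) ^ n * h ^ degree R * C"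
      using prod_poly_chebyshev_nodes[OF \<omega>2, of 1 R] leadR C
      by (simp add: node_def h_def power_mult)
    finally have cofactor: "h * (poly R 1 * (\<Prod>m = 1..<n. poly R (node (2 * m)))) = K * C"
      by (simp add: K_def degR[symmetric])
    have "(\<Prod>m = 1..<n. poly (P - 1) (node (2 * m))) =
        (\<Prod>m = 1..<n. node (2 * m) - 1) * (\<Prod>m = 1..<n. poly R (node (2 * m)))"
      unfolding R poly_mult prod.distrib by simp
    moreover have "(\<Prod>m = 1..<n. node (2 * m) - 1) = - h * of_nat (n\<^sup>2)"
      using prod_nontrivial_nodes_minus_1[OF \<omega>2] n
      by (cases n) (simp_all add: node_def h_def power_mult)
    ultimately have "2 * of_nat q * (\<Prod>m = 1..<n. poly (P - 1) (node (2 * m))) =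
        of_nat (n\<^sup>2) * (h * (poly R 1 * (\<Prod>m = 1..<n. poly R (node (2 * m)))))"
      unfolding R1 by (simp add: ac_simps)
    then show ?thesis
      unfolding cofactor .
  qed

  \<comment> \<open>The leading coefficients and the normalizations \<open>h\<close> of both families combine to a single
  constant, in which the signs square away.\<close>
  have "K * K = 4 ^ ?S"
  proof -
    have "K * K = ((2 ^ ?S)\<^sup>2) ^ n * (h\<^sup>2) ^ ?S"
      by (simp add: K_def power2_eq_square power_mult_distrib[symmetric] ac_simps)
    also have "(2 ^ ?S)\<^sup>2 = (4 :: complex) ^ ?S"
      by (simp add: power2_eq_square flip: power_mult_distrib)
    also have "h\<^sup>2 = 1 / 4 ^ (n - 1)"
      by (simp add: h_def power2_eq_square flip: power_mult_distrib)
    also have "(4 ^ ?S) ^ n * (1 / 4 ^ (n - 1) :: complex) ^ ?S = 4 ^ ?S"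
      using n by (cases n) (simp_all add: power_one_over power_add flip: power_mult, simp add: mult.commute)
    finally show ?thesis .
  qed
  then have "2 * of_nat q * of_nat (2 * n * \<tau>) = of_nat (n\<^sup>2) * 4 ^ ?S * C * B"
    unfolding \<tau> odd mult.assoc[symmetric] even by (simp add: ac_simps)
  moreover have "(4 :: complex) ^ ?S = 4 * 4 ^ (?S - 1)"
    using sk by (cases ?S) auto
  ultimately have "of_nat q * of_nat \<tau> = of_nat n * 4 ^ (?S - 1) * C * B"
    using n by (simp add: power2_eq_square)
  then show ?thesis
    using q_pos by (simp add: C_def B_def field_simps)
qed

end
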